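(* Let $n\ge 6$ and let $\Gamma$ be an unbalanced signed bipartite graph on $n$ vertices containing no negative cycle of length $4$. Then \[ \rho(\Gamma)\le \begin{cases} \frac{1}{4}\left(n-6+\sqrt{(n-2)(n+6)}\right) & \text{if } n \text{ is even}, \\ \sqrt{\frac{1}{8}\left(n^2-4n+11+\sqrt{(n^2-4n+11)^2-64(n-2)(n-4)}\right)} & \text{if } n \text{ is odd}, \end{cases} \] and equality holds if and only if $\Gamma$ is switching isomorphic to $\Gamma_{\lfloor n/2\rfloor,\lceil n/2\rceil}$.
   Context: All graphs are simple (not necessarily connected). A signed graph $\Gamma=(G,\sigma)$ is a simple graph $G$ together with a map $\sigma:E(G)\to\{-1,1\}$; an edge $e$ is positive if $\sigma(e)=1$ and negative if $\sigma(e)=-1$. The adjacency matrix $A(\Gamma)=(a_{uv})$ has $a_{uv}=\sigma(uv)$ if $uv\in E(G)$ and $a_{uv}=0$ otherwise; the spectral radius $\rho(\Gamma)$ is the largest absolute value of an eigenvalue of $A(\Gamma)$. A signed graph is bipartite if its underlying graph is bipartite. A cycle is negative if it contains an odd number of negative edges; $\Gamma$ is unbalanced if it contains at least one negative cycle. For $U\subseteq V(G)$, switching in $U$ reverses the signs of all edges with exactly one endpoint in $U$; two signed graphs are switching equivalent if one is obtained from the other by switching in some vertex subset, and switching isomorphic if one is isomorphic to a signed graph switching equivalent to the other. For $3\le r\le s$, $\Gamma_{r,s}$ denotes the signed bipartite graph obtained from the complete bipartite graph $K_{r-1,s-1}$ with all edges positive by deleting one edge $uv$ and adding two new vertices $u_1,v_1$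 with edges $uv_1$, $v_1u_1$, $u_1v$ (a path of length three from $u$ to $v$), where $v_1u_1$ is the only negative edge. *)

theory Defs
  imports
    "Graph_Theory.Graph_Theory"
    "Jordan_Normal_Form.Spectral_Radius"
begin

text \<open>
  The underlying graph is a \<^locale>\<open>pair_graph\<close>: a finite, loop-free graph without parallel
  edges, each edge \<open>uv\<close> being stored as the two arcs \<open>(u, v)\<close> and \<open>(v, u)\<close>.  The sign of the
  edge \<open>uv\<close> is the value at the unordered pair \<open>{u, v}\<close>; values at other sets are irrelevant, so
  no definition below may depend on them.
\<close>

type_synonym 'a signed_graph = "'a pair_pre_digraph \<times> ('a set \<Rightarrow> int)"

abbreviation sverts :: "'a signed_graph \<Rightarrow> 'a set" where
  "sverts \<Gamma> \<equiv> pverts (fst \<Gamma>)"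

abbreviation sarcs :: "'a signed_graph \<Rightarrow> ('a \<times> 'a) set" where
  "sarcs \<Gamma> \<equiv> parcs (fst \<Gamma>)"

abbreviation esign :: "'a signed_graph \<Rightarrow> 'a \<Rightarrow> 'a \<Rightarrow> int" where
  "esign \<Gamma> u v \<equiv> snd \<Gamma> {u, v}"

definition signed_graph :: "'a signed_graph \<Rightarrow> bool" where
  "signed_graph \<Gamma> \<longleftrightarrow>
     pair_graph (fst \<Gamma>) \<and> (\<forall>(u, v) \<in> sarcs \<Gamma>. esign \<Gamma> u v \<in> {-1, 1})"

definition sg_bipartite :: "'a signed_graph \<Rightarrow> bool" where
  "sg_bipartite \<Gamma> \<longleftrightarrow>
     (\<exists>X Y. X \<union> Y = sverts \<Gamma> \<and> X \<inter> Y = {} \<and> sarcs \<Gamma> \<subseteq> X \<times> Y \<union> Y \<times> X)"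

text \<open>
  The digraph notion \<^const>\<open>pre_digraph.cycle\<close> also admits the closed walks \<open>u, v, u\<close> of length
  two, which are not cycles of the undirected graph.
\<close>

definition negative_cycle :: "'a signed_graph \<Rightarrow> ('a \<times> 'a) list \<Rightarrow> bool" where
  "negative_cycle \<Gamma> p \<longleftrightarrow>
     pre_digraph.cycle (with_proj (fst \<Gamma>)) p \<and> 3 \<le> length p \<and>
     odd (length (filter (\<lambda>(u, v). esign \<Gamma> u v = -1) p))"

definition unbalanced :: "'a signed_graph \<Rightarrow> bool" where
  "unbalanced \<Gamma> \<longleftrightarrow> (\<exists>p. negative_cycle \<Gamma> p)"

definition switch :: "'a set \<Rightarrow> 'a signed_graph \<Rightarrow> 'a signed_graph" where
  "switch U \<Gamma> = (fst \<Gamma>, \<lambda>e. if card (e \<inter> U) = 1 then - snd \<Gamma> e else snd \<Gamma> e)"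

definition switching_equivalent :: "'a signed_graph \<Rightarrow> 'a signed_graph \<Rightarrow> bool" where
  "switching_equivalent \<Gamma> \<Gamma>' \<longleftrightarrow>
     (\<exists>U \<subseteq> sverts \<Gamma>. fst \<Gamma>' = fst \<Gamma> \<and>
        (\<forall>(u, v) \<in> sarcs \<Gamma>. esign \<Gamma>' u v = esign (switch U \<Gamma>) u v))"

definition sg_isomorphic :: "'a signed_graph \<Rightarrow> 'b signed_graph \<Rightarrow> bool" where
  "sg_isomorphic \<Gamma> \<Gamma>' \<longleftrightarrow>
     (\<exists>f. bij_betw f (sverts \<Gamma>) (sverts \<Gamma>') \<and>
        (\<forall>u \<in> sverts \<Gamma>. \<forall>v \<in> sverts \<Gamma>. (u, v) \<in> sarcs \<Gamma> \<longleftrightarrow> (f u, f v) \<in> sarcs \<Gamma>') \<and>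
        (\<forall>(u, v) \<in> sarcs \<Gamma>. esign \<Gamma>' (f u) (f v) = esign \<Gamma> u v))"

definition switching_isomorphic :: "'a signed_graph \<Rightarrow> 'b signed_graph \<Rightarrow> bool" where
  "switching_isomorphic \<Gamma> \<Gamma>' \<longleftrightarrow>
     (\<exists>H. switching_equivalent \<Gamma>' H \<and> sg_isomorphic \<Gamma> H)"

text \<open>
  For \<open>3 \<le> r \<le> s\<close>, the parts of the complete bipartite graph are \<open>Inl i\<close> with \<open>i < r - 1\<close> and
  \<open>Inr j\<close> with \<open>j < s - 1\<close>; the deleted edge joins \<open>u = Inl 0\<close> and \<open>v = Inr 0\<close>, and the new
  vertices are \<open>u\<^sub>1 = Inl (r - 1)\<close> and \<open>v\<^sub>1 = Inr (s - 1)\<close>.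
\<close>

definition Gamma_rs :: "nat \<Rightarrow> nat \<Rightarrow> (nat + nat) signed_graph" where
  "Gamma_rs r s =
     (let u = Inl 0; v = Inr 0; u1 = Inl (r - 1); v1 = Inr (s - 1);
          X = Inl ` {..<r - 1}; Y = Inr ` {..<s - 1};
          E = (X \<times> Y - {(u, v)}) \<union> {(u, v1), (v1, u1), (u1, v)}
      in (\<lparr>pverts = X \<union> Y \<union> {u1, v1}, parcs = E \<union> E\<inverse>\<rparr>,
          \<lambda>e. if e = {v1, u1} then -1 else 1))"

text \<open>
  Matrices are indexed by natural numbers, so the adjacency matrix is taken with respect to a
  list enumerating the vertices.
\<close>

definition adjacency_mat :: "'a list \<Rightarrow> 'a signed_graph \<Rightarrow> 'b :: comm_ring_1 mat" where
  "adjacency_mat vs \<Gamma> =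
     mat (length vs) (length vs)
       (\<lambda>(i, j). if (vs ! i, vs ! j) \<in> sarcs \<Gamma> then of_int (esign \<Gamma> (vs ! i) (vs ! j)) else 0)"

definition sg_spectral_radius :: "'a signed_graph \<Rightarrow> real" where
  "sg_spectral_radius \<Gamma> =
     spectral_radius (adjacency_mat (SOME vs. distinct vs \<and> set vs = sverts \<Gamma>) \<Gamma>)"

lemma eigenvalue_adjacency_mat_iff:
  fixes k :: "'b :: comm_ring_1"
  assumes "distinct vs" "set vs = sverts \<Gamma>"
  shows "eigenvalue (adjacency_mat vs \<Gamma>) k \<longleftrightarrow>
    (\<exists>x. (\<exists>u \<in> sverts \<Gamma>. x u \<noteq> 0) \<and>
       (\<forall>u \<in> sverts \<Gamma>.
          (\<Sum>v \<in> sverts \<Gamma>. (if (u, v) \<in> sarcs \<Gamma> then of_int (esign \<Gamma> u v) else 0) * x v) = k * x u))"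
    (is "?L \<longleftrightarrow> ?R")
proof -
  let ?n = "length vs"
  let ?A = "adjacency_mat vs \<Gamma> :: 'b mat"
  let ?a = "\<lambda>u v. (if (u, v) \<in> sarcs \<Gamma> then of_int (esign \<Gamma> u v) else 0) :: 'b"
  have bij: "bij_betw ((!) vs) {..<?n} (sverts \<Gamma>)"
    using assms bij_betw_nth by blast
  have bij': "bij_betw ((!) vs) {0..<?n} (sverts \<Gamma>)"
    using bij by (simp add: lessThan_atLeast0)
  have A: "?A \<in> carrier_mat ?n ?n"
    by (simp add: adjacency_mat_def)
  have mult: "(?A *\<^sub>v w) $ i = (\<Sum>v \<in> sverts \<Gamma>. ?a (vs ! i) v * x v)"
    if "w \<in> carrier_vec ?n" "i < ?n" "\<And>j. j < ?n \<Longrightarrow> w $ j = x (vs ! j)" for w x i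
  proof -
    have "(?A *\<^sub>v w) $ i = (\<Sum>j \<in> {0..<?n}. ?a (vs ! i) (vs ! j) * x (vs ! j))"
      using that by (simp add: adjacency_mat_def scalar_prod_def)
    also have "\<dots> = (\<Sum>v \<in> sverts \<Gamma>. ?a (vs ! i) v * x v)"
      by (rule sum.reindex_bij_betw[OF bij'])
    finally show ?thesis .
  qed
  show ?thesis
  proof
    assume ?L
    then obtain w where w: "w \<in> carrier_vec ?n" "w \<noteq> 0\<^sub>v ?n" "?A *\<^sub>v w = k \<cdot>\<^sub>v w"
      using A unfolding eigenvalue_def eigenvector_def by auto
    define x where "x u = w $ (the_inv_into {..<?n} ((!) vs) u)" for u
    have x: "w $ j = x (vs ! j)" if "j < ?n" for j
      using that bij by (simp add: x_def the_inv_into_f_f bij_betw_def)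
    obtain i where i: "i < ?n" "w $ i \<noteq> 0"
      using w(1,2) by (metis carrier_vecD eq_vecI index_zero_vec)
    have "(\<Sum>v \<in> sverts \<Gamma>. ?a u v * x v) = k * x u" if u: "u \<in> sverts \<Gamma>" for u
    proof -
      obtain j where j: "j < ?n" "u = vs ! j"
        using u assms(2) by (metis in_set_conv_nth)
      have "(\<Sum>v \<in> sverts \<Gamma>. ?a u v * x v) = (?A *\<^sub>v w) $ j"
        unfolding j(2) by (rule mult[OF w(1) j(1) x, symmetric])
      also have "\<dots> = k * w $ j"
        unfolding w(3) using w(1) j(1) by simp
      finally show ?thesis
        unfolding x[OF j(1)] j(2) .
    qed
    moreover have "vs ! i \<in> sverts \<Gamma>" "x (vs ! i) \<noteq> 0"
      using i x[OF i(1)] assms(2) nth_mem[OF i(1)] by auto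
    ultimately show ?R by blast
  next
    assume ?R
    then obtain x where x: "\<exists>u \<in> sverts \<Gamma>. x u \<noteq> 0"
      "\<forall>u \<in> sverts \<Gamma>. (\<Sum>v \<in> sverts \<Gamma>. ?a u v * x v) = k * x u" by blast
    define w where "w = vec ?n (\<lambda>i. x (vs ! i))"
    have w: "w \<in> carrier_vec ?n" "\<And>j. j < ?n \<Longrightarrow> w $ j = x (vs ! j)"
      by (simp_all add: w_def)
    have "w \<noteq> 0\<^sub>v ?n"
      using x(1) w(2) assms(2) by (metis in_set_conv_nth index_zero_vec(1))
    moreover have "?A *\<^sub>v w = k \<cdot>\<^sub>v w"
    proof (rule eq_vecI)
      fix i assume "i < dim_vec (k \<cdot>\<^sub>v w)"
      then have i: "i < ?n" by (simp add: w_def)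
      have "vs ! i \<in> sverts \<Gamma>"
        using assms(2) nth_mem[OF i] by blast
      then have "(?A *\<^sub>v w) $ i = k * x (vs ! i)"
        using x(2) by (simp only: mult[where x = x, OF w(1) i w(2)])
      then show "(?A *\<^sub>v w) $ i = (k \<cdot>\<^sub>v w) $ i"
        using w(1) w(2)[OF i] i by simp
    qed (use A w in auto)
    ultimately show ?L
      using A w(1) unfolding eigenvalue_def eigenvector_def by auto
  qed
qed

lemma sg_spectral_radius_eq:
  assumes "distinct vs" "set vs = sverts \<Gamma>"
  shows "sg_spectral_radius \<Gamma> = spectral_radius (adjacency_mat vs \<Gamma>)"
proof -
  let ?ws = "SOME vs. distinct vs \<and> set vs = sverts \<Gamma>"
  have "distinct ?ws \<and> set ?ws = sverts \<Gamma>"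
    by (rule someI[of _ vs]) (use assms in simp)
  then have ws: "distinct ?ws" "set ?ws = sverts \<Gamma>" by blast+
  have "spectrum (adjacency_mat ?ws \<Gamma> :: complex mat) = spectrum (adjacency_mat vs \<Gamma>)"
    unfolding spectrum_def eigenvalue_adjacency_mat_iff[OF ws] eigenvalue_adjacency_mat_iff[OF assms] ..
  then show ?thesis
    by (simp add: sg_spectral_radius_def spectral_radius_def)
qed

end

(*
  Switch so that an eigenvector z of rho is nonnegative, with as few negative edges as possible;
  then every vertex on a negative edge also lies on a positive one. Fix a negative edge u1 v1 and
  let P and Q be the positive neighbours of v1 and u1, A and B the remaining vertices of the two
  parts. Since there is no negative 4-cycle, no positive edge joins P to Q, so the weights are at
  most those of a blow-up of a negative hexagon with classes {u1}, P, A, {v1}, Q, B. Its biadjacency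
  matrix M has rank two: with R = |P| + |A| and S = |Q| + |B|, the nonzero eigenvalues of M M^T are
  the roots of t^2 - T t + D, where T = R S + 2 - (|P| - 1)(|Q| - 1) and
  D = (|A||P| + R)(|B||Q| + S). The classes A and B are nonempty, as otherwise the graph would be
  balanced. So T is largest and D is smallest exactly for the graphs Gamma_{R+1,S+1}, and then
  R, S as equal as possible gives the bound.
*)
theory Submission
  imports Defs "HOL-Analysis.Analysis"
begin

text \<open>Roots of different quadratics are never compared as closed forms. \<open>t\<close> is
  fixed as the square of the claimed bound; it lies above both roots for given class sizes as soon
  as the quadratic is nonnegative at \<open>t\<close> and \<open>2 * t\<close> is at least its trace
  term. The value at \<open>t\<close> splits into nonnegative terms, and their simultaneous
  vanishing gives the cases of equality.

  \<open>M\<close> has rank two because its row on \<open>A\<close> is the sum of its rows on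
  \<open>u1\<close> and on \<open>P\<close>. So no spectral theory of \<open>M\<close> is used: the
  claim that \<open>t\<close> bounds the squared norm becomes the semidefiniteness of a symmetric
  2x2 matrix.

  The zeros of the eigenvector are the obstacle. They leave the signs of the switching undetermined,
  hence the minimality in its choice. In the case of equality they hide differences between the
  weights and \<open>M\<close>; only \<open>u1\<close> and \<open>v1\<close> can then be zeros, so
  the comparison by rows and the one by columns together determine all weights. For this reason the
  setting is kept symmetric in the two parts.\<close>

section \<open>The quadratic form of the hexagon\<close>

text \<open>With nonnegative determinant, the symmetric matrix with entries \<open>z1\<close>,
  \<open>z2\<close>, \<open>z3\<close> is semidefinite of one sign. Its trace pairing with the
  positive definite matrix with entries \<open>w1\<close>, \<open>-1\<close>, \<open>w3\<close>
  decides which: it would be negative on a nonzero negative semidefinite matrix.\<close>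

lemma psd_2x2_diag_nonneg:
  fixes z1 z2 z3 w1 w3 :: real
  assumes det: "z2\<^sup>2 \<le> z1 * z3"
    and w: "w1 > 0" "w3 > 0" "w1 * w3 > 1"
    and tr: "w1 * z1 - 2 * z2 + w3 * z3 \<ge> 0"
  shows "z1 \<ge> 0"
proof (rule ccontr)
  assume "\<not> z1 \<ge> 0"
  then have z1: "z1 < 0" by simp
  have z3: "z3 \<le> 0"
  proof (rule ccontr)
    assume "\<not> z3 \<le> 0"
    then have "z1 * z3 < 0" using z1 by (simp add: mult_neg_pos)
    then show False using det by (smt (verit) zero_le_power2)
  qed
  define s where "s = - w1 * z1 - w3 * z3"
  have "w1 * z1 < 0" "w3 * z3 \<le> 0" using z1 z3 w by (simp_all add: mult_pos_neg mult_nonneg_nonpos)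
  then have s: "s > 0" unfolding s_def by linarith
  have "s\<^sup>2 = (w1 * z1 - w3 * z3)\<^sup>2 + 4 * (w1 * w3) * (z1 * z3)"
    by (simp add: s_def power2_eq_square algebra_simps)
  then have 1: "s\<^sup>2 \<ge> (w1 * z1 - w3 * z3)\<^sup>2 + 4 * (z1 * z3) + 4 * (w1 * w3 - 1) * (z1 * z3)"
    by (simp add: algebra_simps)
  have nn: "z1 * z3 \<ge> 0" using z1 z3 by (simp add: mult_nonpos_nonpos)
  have "(w1 * z1 - w3 * z3)\<^sup>2 + 4 * (w1 * w3 - 1) * (z1 * z3) > 0"
  proof (cases "z3 = 0")
    case True
    then show ?thesis using z1 w by simp
  next
    case False
    then have "z1 * z3 > 0" using z1 z3 by (simp add: mult_neg_neg)
    then show ?thesis using w by (intro add_nonneg_pos) auto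
  qed
  then have "s\<^sup>2 > (2 * z2)\<^sup>2" using 1 det by (simp add: power_mult_distrib)
  then have "\<bar>2 * z2\<bar> < s" using s by (metis abs_le_square_iff abs_of_pos not_le)
  then show False using tr unfolding s_def by linarith
qed

lemma psd_2x2_form:
  fixes z1 z2 z3 f g :: real
  assumes "z1 \<ge> 0" "z3 \<ge> 0" "z2\<^sup>2 \<le> z1 * z3"
  shows "z1 * f\<^sup>2 + 2 * z2 * f * g + z3 * g\<^sup>2 \<ge> 0"
proof (cases "z1 = 0")
  case True
  then show ?thesis using assms by simp
next
  case False
  have "z1 * (z1 * f\<^sup>2 + 2 * z2 * f * g + z3 * g\<^sup>2) = (z1 * f + z2 * g)\<^sup>2 + (z1 * z3 - z2\<^sup>2) * g\<^sup>2"
    by (simp add: power2_eq_square algebra_simps)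
  also have "\<dots> \<ge> 0" using assms by simp
  finally show ?thesis using False assms(1) by (simp add: zero_le_mult_iff)
qed

lemma pd_2x2_form:
  fixes z1 z2 z3 f g :: real
  assumes "z1 \<ge> 0" "z2\<^sup>2 < z1 * z3" "f \<noteq> 0 \<or> g \<noteq> 0"
  shows "z1 * f\<^sup>2 + 2 * z2 * f * g + z3 * g\<^sup>2 > 0"
proof -
  have z1: "z1 > 0" using assms(1,2) by (cases "z1 = 0") auto
  have "z1 * (z1 * f\<^sup>2 + 2 * z2 * f * g + z3 * g\<^sup>2) = (z1 * f + z2 * g)\<^sup>2 + (z1 * z3 - z2\<^sup>2) * g\<^sup>2"
    by (simp add: power2_eq_square algebra_simps)
  also have "\<dots> > 0"
  proof (cases "g = 0")
    case True
    then show ?thesis using assms(3) z1 by simp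
  next
    case False
    then show ?thesis using assms(2) by (intro add_nonneg_pos) auto
  qed
  finally show ?thesis using z1 by (simp add: zero_less_mult_iff)
qed

context
  fixes p a q b R S t :: real
  assumes ge1: "p \<ge> 1" "a \<ge> 1" "q \<ge> 1" "b \<ge> 1"
    and RS: "R = p + a" "S = q + b"
    and half: "2 * t \<ge> R * S + 2 - (p - 1) * (q - 1)"
begin

text \<open>
  With \<open>z1\<close>, \<open>z2\<close>, \<open>z3\<close> the entries of \<open>t H - \<Delta> G\<close>, where \<open>G\<close> and \<open>H\<close> are the matrices of
  \<open>f\<^sup>2 + p g\<^sup>2 + a (f + g)\<^sup>2\<close> and \<open>(1 + b) f\<^sup>2 + 2 f g + (1 + q) g\<^sup>2\<close>, and \<open>\<Delta> = q b + S = det H\<close>.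
\<close>

lemma hexagon_form_identities:
  defines "z1 \<equiv> t * (1 + b) - (q * b + S) * (1 + a)"
    and "z2 \<equiv> t - (q * b + S) * a"
    and "z3 \<equiv> t * (1 + q) - (q * b + S) * (p + a)"
  shows "z1 * z3 - z2\<^sup>2 = (q * b + S) * (t\<^sup>2 - (R * S + 2 - (p - 1) * (q - 1)) * t + (a * p + R) * (b * q + S))"
    and "(1 + q) * z1 - 2 * z2 + (1 + b) * z3 = (q * b + S) * (2 * t - (R * S + 2 - (p - 1) * (q - 1)))"
  unfolding z1_def z2_def z3_def RS by (simp_all add: power2_eq_square algebra_simps)

text \<open>\<open>\<eta>\<close>, \<open>U\<close>, \<open>V\<close> stand for \<open>z v1\<close>
  and the sums of \<open>z\<close> over \<open>Q\<close> and \<open>B\<close>, and \<open>N\<close>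
  for the squared norm on that part. For given \<open>f\<close> and \<open>g\<close> the least
  \<open>N\<close> is the form of \<open>H\<close> divided by \<open>\<Delta>\<close>, so the bound
  amounts to \<open>t H - \<Delta> G\<close> being positive semidefinite. Its determinant and its
  pairing with the adjugate of \<open>H\<close> are the two quantities assumed nonnegative, up to
  the factor \<open>\<Delta>\<close>.\<close>

lemma hexagon_form_bound:
  fixes \<eta> U V N :: real
  assumes N: "N \<ge> \<eta>\<^sup>2 + U\<^sup>2 / q + V\<^sup>2 / b"
    and det: "t\<^sup>2 - (R * S + 2 - (p - 1) * (q - 1)) * t + (a * p + R) * (b * q + S) \<ge> 0"
  defines "f \<equiv> U - \<eta>" and "g \<equiv> V + \<eta>"
  shows "f\<^sup>2 + p * g\<^sup>2 + a * (f + g)\<^sup>2 \<le> t * N"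
    and "t\<^sup>2 - (R * S + 2 - (p - 1) * (q - 1)) * t + (a * p + R) * (b * q + S) > 0 \<Longrightarrow> N > 0 \<Longrightarrow>
      f\<^sup>2 + p * g\<^sup>2 + a * (f + g)\<^sup>2 < t * N"
proof -
  define \<Delta> where "\<Delta> = q * b + S"
  define z1 z2 z3 where z: "z1 = t * (1 + b) - \<Delta> * (1 + a)" "z2 = t - \<Delta> * a" "z3 = t * (1 + q) - \<Delta> * (p + a)"
  have \<Delta>: "\<Delta> > 0" unfolding \<Delta>_def RS using ge1 by (simp add: add_pos_pos)
  have "p * q \<ge> 0" "p * b \<ge> 0" "a * q \<ge> 0" "a * b \<ge> 0" using ge1 by simp_all
  then have "R * S + 2 - (p - 1) * (q - 1) > 0"
    unfolding RS using ge1 by (simp add: algebra_simps add_pos_nonneg)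
  then have t: "t > 0" using half by simp
  note id = hexagon_form_identities[folded \<Delta>_def, folded z]
  have z13: "z2\<^sup>2 \<le> z1 * z3"
    using id(1) det \<Delta> by (smt (verit) mult_nonneg_nonneg)
  have tr: "(1 + q) * z1 - 2 * z2 + (1 + b) * z3 \<ge> 0"
    unfolding id(2) using \<Delta> half by simp
  have qb: "(1 + q) * (1 + b) > 1" using \<Delta> unfolding \<Delta>_def RS by (simp add: algebra_simps)
  have z1: "z1 \<ge> 0" using psd_2x2_diag_nonneg[OF z13 _ _ qb tr] ge1 by simp
  have z3: "z3 \<ge> 0"
    using psd_2x2_diag_nonneg[of z2 z3 z1 "1 + b" "1 + q"] z13 qb tr ge1 by (simp add: algebra_simps)
  have cs: "(1 + b) * f\<^sup>2 + 2 * f * g + (1 + q) * g\<^sup>2 \<le> \<Delta> * N"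
  proof -
    \<comment> \<open>The defect is a square that vanishes exactly at the vector of least norm with
      the given \<open>f\<close> and \<open>g\<close>.\<close>
    have "\<Delta> * (\<eta>\<^sup>2 + U\<^sup>2 / q + V\<^sup>2 / b) - ((1 + b) * f\<^sup>2 + 2 * f * g + (1 + q) * g\<^sup>2)
        = (b * U - q * V + q * b * \<eta>)\<^sup>2 / (q * b)"
      unfolding \<Delta>_def RS f_def g_def using ge1 by (simp add: field_simps power2_eq_square)
    also have "\<dots> \<ge> 0" using ge1 by simp
    finally show ?thesis using N \<Delta> by (smt (verit) mult_left_mono)
  qed
  have eq: "t * ((1 + b) * f\<^sup>2 + 2 * f * g + (1 + q) * g\<^sup>2) - \<Delta> * (f\<^sup>2 + p * g\<^sup>2 + a * (f + g)\<^sup>2)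
     = z1 * f\<^sup>2 + 2 * z2 * f * g + z3 * g\<^sup>2"
    unfolding z by (simp add: power2_eq_square algebra_simps)
  have cs': "t * ((1 + b) * f\<^sup>2 + 2 * f * g + (1 + q) * g\<^sup>2) \<le> \<Delta> * (t * N)"
    using mult_left_mono[OF cs, of t] t by (simp add: algebra_simps)
  have "\<Delta> * (f\<^sup>2 + p * g\<^sup>2 + a * (f + g)\<^sup>2) \<le> \<Delta> * (t * N)"
    using cs' eq psd_2x2_form[OF z1 z3 z13, of f g] by linarith
  then show "f\<^sup>2 + p * g\<^sup>2 + a * (f + g)\<^sup>2 \<le> t * N" using \<Delta> by simp
  assume strict: "t\<^sup>2 - (R * S + 2 - (p - 1) * (q - 1)) * t + (a * p + R) * (b * q + S) > 0" and N0: "N > 0"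
  show "f\<^sup>2 + p * g\<^sup>2 + a * (f + g)\<^sup>2 < t * N"
  proof (cases "f = 0 \<and> g = 0")
    case True
    then show ?thesis using t N0 by simp
  next
    case False
    have "z2\<^sup>2 < z1 * z3" using id(1) strict \<Delta> by (smt (verit) mult_pos_pos)
    then have "\<Delta> * (f\<^sup>2 + p * g\<^sup>2 + a * (f + g)\<^sup>2) < \<Delta> * (t * N)"
      using cs' eq pd_2x2_form[OF z1, of z2 z3 f g] False by linarith
    then show ?thesis using \<Delta> by simp
  qed
qed

end

section \<open>The extremal parameters\<close>

text \<open>\<open>4 * R * S\<close> is the square of the sum minus the square of the difference,
  and parity keeps the difference at least \<open>S0 - R0\<close>. The offset \<open>- 1\<close> is
  there because \<open>R\<close> and \<open>S\<close> count each part without its end of the chosen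
  negative edge.\<close>

lemma prod_le_of_sum_eq:
  fixes R S n :: nat
  assumes "R + S = n - 2" "n \<ge> 6"
  defines "R0 \<equiv> n div 2 - 1" and "S0 \<equiv> (n + 1) div 2 - 1"
  shows "R * S \<le> R0 * S0" and "R * S = R0 * S0 \<Longrightarrow> R \<le> S \<Longrightarrow> R = R0 \<and> S = S0"
proof -
  have 0: "R0 \<le> S0" "S0 \<le> R0 + 1" "R0 + S0 = R + S" using assms by auto
  have key: "\<bar>int S - int R\<bar> \<ge> int S0 - int R0"
  proof (cases "R = S")
    case True
    then have "R0 = S0" using 0 by presburger
    then show ?thesis by simp
  qed (use 0 in linarith)
  have e: "4 * (int R0 * int S0 - int R * int S) = (int S - int R)\<^sup>2 - (int S0 - int R0)\<^sup>2"
  proof -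
    have "(int R0 + int S0)\<^sup>2 = (int R + int S)\<^sup>2" using 0(3) by (metis of_nat_add)
    then show ?thesis by (simp add: power2_eq_square algebra_simps)
  qed
  have "(int S0 - int R0)\<^sup>2 \<le> (int S - int R)\<^sup>2"
    using key 0(1) by (metis abs_ge_zero abs_of_nonneg diff_ge_0_iff_ge of_nat_mono power2_abs power_mono)
  then have "int (R * S) \<le> int (R0 * S0)" using e by simp
  then show "R * S \<le> R0 * S0" by linarith
  assume eq: "R * S = R0 * S0" and le: "R \<le> S"
  have "int R0 * int S0 - int R * int S = 0" using eq by (metis of_nat_mult diff_self)
  then have "(int S - int R)\<^sup>2 = (int S0 - int R0)\<^sup>2" using e by simp
  then have "int S - int R = int S0 - int R0"
    by (rule power2_eq_imp_eq) (use le 0(1) in auto)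
  then show "R = R0 \<and> S = S0" using 0(3) by linarith
qed

text \<open>Subtracting the extremal quadratic, which vanishes at \<open>t\<close>, leaves three
  nonnegative terms: one for unequal part sizes, one for the loss \<open>(p - 1) * (q - 1)\<close>
  in the trace, one for the excess of the constant term. Equality makes each of them zero.\<close>

lemma hexagon_quadratic_extremal:
  fixes p a q b R S n :: nat and t :: real
  assumes ge1: "p \<ge> 1" "a \<ge> 1" "q \<ge> 1" "b \<ge> 1"
    and RS: "R = p + a" "S = q + b" "R + S = n - 2" "R \<le> S" and n: "n \<ge> 6"
  defines "R0 \<equiv> n div 2 - 1" and "S0 \<equiv> (n + 1) div 2 - 1"
  assumes root: "t\<^sup>2 - (real R0 * real S0 + 2) * t + (2 * real R0 - 1) * (2 * real S0 - 1) = 0"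
    and half: "2 * t \<ge> real R0 * real S0 + 2"
  defines "T \<equiv> real R * real S + 2 - (real p - 1) * (real q - 1)"
    and "D \<equiv> (real a * real p + real R) * (real b * real q + real S)"
  shows "2 * t \<ge> T" and "t\<^sup>2 - T * t + D \<ge> 0"
    and "t\<^sup>2 - T * t + D = 0 \<Longrightarrow> R = R0 \<and> S = S0 \<and> (p = 1 \<and> q = 1 \<or> p = 1 \<and> b = 1 \<or> a = 1 \<and> q = 1)"
proof -
  note le = prod_le_of_sum_eq[OF RS(3) n, folded R0_def S0_def]
  have le': "real R * real S \<le> real R0 * real S0" using le(1) by (metis of_nat_le_iff of_nat_mult)
  have ge: "real p \<ge> 1" "real q \<ge> 1" "real a \<ge> 1" "real b \<ge> 1" using ge1 by simp_all
  have pq: "(real p - 1) * (real q - 1) \<ge> 0" using ge by simp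
  show "2 * t \<ge> T" using half le' pq unfolding T_def by linarith
  have sum: "real R0 + real S0 = real R + real S"
  proof -
    have "R0 + S0 = R + S" using RS(3) n R0_def S0_def by auto
    then show ?thesis by (metis of_nat_add)
  qed
  have t: "t > 0" using half by (smt (verit) mult_nonneg_nonneg of_nat_0_le_iff)
  have pq0: "R * S = R0 * S0 \<or> t > 4"
  proof (cases "n \<ge> 8")
    case True
    then have "R0 \<ge> 3" "S0 \<ge> 3" unfolding R0_def S0_def by linarith+
    then have "3 * 3 \<le> R0 * S0" by (intro mult_le_mono)
    then have "9 \<le> real R0 * real S0" by (simp flip: of_nat_mult)
    then show ?thesis using half by linarith
  next
    case False
    \<comment> \<open>Here \<open>n - 2\<close> is 4 or 5, and \<open>2 \<le> R \<le> S\<close>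
      leaves a single splitting.\<close>
    then have "R = 2" "R0 = 2" "S = n - 4" "S0 = n - 4" using RS ge1 n unfolding R0_def S0_def by auto
    then show ?thesis by simp
  qed
  have t1: "(real R0 * real S0 - real R * real S) * (t - 4) \<ge> 0"
    using pq0
  proof
    assume "R * S = R0 * S0"
    then have "real R * real S = real R0 * real S0" by (metis of_nat_mult)
    then show ?thesis by simp
  qed (use le' in simp)
  have t2: "(real p - 1) * (real q - 1) * t \<ge> 0" using pq t by simp
  \<comment> \<open>For fixed \<open>R\<close>, the factor \<open>a * p + R\<close> has minimum
    \<open>2 * R - 1\<close>, attained when \<open>a\<close> or \<open>p\<close> is 1;
    \<open>\<alpha>\<close> is the excess over it, and \<open>\<beta>\<close> the analogous excess
    for \<open>S\<close>.\<close>
  define \<alpha> \<beta> where \<alpha>\<beta>: "\<alpha> = (real a - 1) * (real p - 1)" "\<beta> = (real b - 1) * (real q - 1)"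
  have nn: "\<alpha> \<ge> 0" "\<beta> \<ge> 0" unfolding \<alpha>\<beta> using ge by simp_all
  have D: "D = (2 * real R - 1 + \<alpha>) * (2 * real S - 1 + \<beta>)"
    unfolding D_def \<alpha>\<beta> RS(1,2) by (simp add: algebra_simps)
  have RS1: "2 * real R - 1 > 0" "2 * real S - 1 > 0" using RS(1,2) ge by simp_all
  have t3: "\<alpha> * (2 * real S - 1) + \<beta> * (2 * real R - 1) + \<alpha> * \<beta> \<ge> 0"
    using nn RS1 by simp
  have "2 * real R0 + 2 * real S0 = 2 * real R + 2 * real S" using sum by simp
  then have D0: "(2 * real R0 - 1) * (2 * real S0 - 1) = 4 * (real R0 * real S0) + 1 - 2 * real R - 2 * real S"
    by (simp add: algebra_simps)
  \<comment> \<open>\<open>R + S\<close> is fixed, so the quadratic depends on \<open>R\<close> and \<open>S\<close> only through \<open>R S\<close>, with slope \<open>4 - t\<close>;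
    for \<open>n < 8\<close> the product \<open>R S\<close> is determined.\<close>
  have eq: "t\<^sup>2 - T * t + D = (real R0 * real S0 - real R * real S) * (t - 4) + (real p - 1) * (real q - 1) * t
     + (\<alpha> * (2 * real S - 1) + \<beta> * (2 * real R - 1) + \<alpha> * \<beta>)"
    using root unfolding D0 unfolding T_def D by (simp add: algebra_simps)
  then show "t\<^sup>2 - T * t + D \<ge> 0" using t1 t2 t3 by linarith
  assume "t\<^sup>2 - T * t + D = 0"
  then have z: "(real R0 * real S0 - real R * real S) * (t - 4) = 0" "(real p - 1) * (real q - 1) * t = 0"
     "\<alpha> * (2 * real S - 1) + \<beta> * (2 * real R - 1) + \<alpha> * \<beta> = 0"
    using eq t1 t2 t3 by linarith+
  have "real R * real S = real R0 * real S0 \<or> t = 4" using z(1) by auto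
  then have "R * S = R0 * S0" using pq0 by (auto simp flip: of_nat_mult)
  then have "R = R0 \<and> S = S0" using le(2) RS(4) by blast
  moreover have "\<alpha> * (2 * real S - 1) \<ge> 0" "\<beta> * (2 * real R - 1) \<ge> 0" "\<alpha> * \<beta> \<ge> 0" using nn RS1 by simp_all
  then have "\<alpha> * (2 * real S - 1) = 0" "\<beta> * (2 * real R - 1) = 0" using z(3) by linarith+
  then have "\<alpha> = 0" "\<beta> = 0" using RS1 by simp_all
  then have "(a = 1 \<or> p = 1) \<and> (b = 1 \<or> q = 1)" unfolding \<alpha>\<beta> by simp
  moreover have "p = 1 \<or> q = 1" using z(2) t by simp
  ultimately show "R = R0 \<and> S = S0 \<and> (p = 1 \<and> q = 1 \<or> p = 1 \<and> b = 1 \<or> a = 1 \<and> q = 1)" by blast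
qed

definition extremal_radius :: "nat \<Rightarrow> real" where
  "extremal_radius n =
      (if even n
       then (1/4) * (real n - 6 + sqrt ((real n - 2) * (real n + 6)))
       else sqrt ((1/8) * ((real n)\<^sup>2 - 4 * real n + 11
              + sqrt (((real n)\<^sup>2 - 4 * real n + 11)\<^sup>2 - 64 * (real n - 2) * (real n - 4)))))"

text \<open>The last claim says which root the square of the radius is: being at least half the sum
  of the roots, it is the larger one.\<close>

lemma extremal_radius_root:
  fixes n :: nat
  assumes n: "n \<ge> 6"
  defines "R0 \<equiv> n div 2 - 1" and "S0 \<equiv> (n + 1) div 2 - 1" and "t \<equiv> (extremal_radius n)\<^sup>2"
  shows "extremal_radius n > 0"
    and "t\<^sup>2 - (real R0 * real S0 + 2) * t + (2 * real R0 - 1) * (2 * real S0 - 1) = 0"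
    and "2 * t \<ge> real R0 * real S0 + 2"
proof -
  have "extremal_radius n > 0 \<and> t\<^sup>2 - (real R0 * real S0 + 2) * t + (2 * real R0 - 1) * (2 * real S0 - 1) = 0 \<and>
     2 * t \<ge> real R0 * real S0 + 2"
  proof (cases "even n")
    case True
    then obtain k where k: "n = 2 * k" by blast
    then have k3: "real k \<ge> 3" using n by simp
    have R0: "real R0 = real k - 1" "real S0 = real k - 1" unfolding R0_def S0_def k using k3 by auto
    define s where "s = sqrt ((real k - 1) * (real k + 3))"
    have s2: "s\<^sup>2 = (real k - 1) * (real k + 3)" unfolding s_def using k3 by simp
    have s0: "s > 0" unfolding s_def using k3 by simp
    have "(real n - 2) * (real n + 6) = 4 * ((real k - 1) * (real k + 3))" unfolding k by (simp add: algebra_simps)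
    then have "sqrt ((real n - 2) * (real n + 6)) = 2 * s" by (simp add: s_def real_sqrt_mult)
    then have B: "extremal_radius n = (real k - 3 + s) / 2" using True by (simp add: extremal_radius_def k)
    have pos: "extremal_radius n > 0" unfolding B using s0 k3 by simp
    \<comment> \<open>For equal parts the constant term is the square of \<open>2 * k - 3\<close>,
      so the quadratic in \<open>t\<close> splits into two quadratics in the radius itself. This is
      why the even case has no nested root.\<close>
    have q: "(extremal_radius n)\<^sup>2 = (real k - 3) * extremal_radius n + (2 * real k - 3)"
      unfolding B using s2 by (simp add: power2_eq_square field_simps)
    have t1: "(t - (2 * real k - 3))\<^sup>2 = (real k - 3)\<^sup>2 * t"
      unfolding t_def q by (simp add: power_mult_distrib q)
    then have root: "t\<^sup>2 - (real R0 * real S0 + 2) * t + (2 * real R0 - 1) * (2 * real S0 - 1) = 0"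
      unfolding R0 by (simp add: power2_eq_square algebra_simps)
    have tge: "t \<ge> 2 * real k - 3" unfolding t_def q using pos k3 by simp
    \<comment> \<open>The product of the roots is the square of \<open>2 * k - 3\<close>, so a root
      that is at least \<open>2 * k - 3\<close> is the larger one.\<close>
    have "t * (2 * t - (real R0 * real S0 + 2)) = t\<^sup>2 - (2 * real k - 3)\<^sup>2"
      using root unfolding R0 by (simp add: power2_eq_square algebra_simps)
    also have "\<dots> \<ge> 0" using tge k3 by (simp add: power_mono)
    finally have "2 * t - (real R0 * real S0 + 2) \<ge> 0" using tge k3 by (simp add: zero_le_mult_iff)
    then show ?thesis using pos root by simp
  next
    case False
    then obtain k where k: "n = 2 * k + 1" using oddE by blast
    then have k3: "real k \<ge> 3" using n by simp
    have R0: "real R0 = real k - 1" "real S0 = real k" unfolding R0_def S0_def k using k3 by auto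
    define T D where TD: "T = real k * (real k - 1) + 2" "D = (2 * real k - 3) * (2 * real k - 1)"
    define s where "s = sqrt (T\<^sup>2 - 4 * D)"
    have disc: "T\<^sup>2 - 4 * D \<ge> 0"
    proof -
      have "T\<^sup>2 - 4 * D = (real k * (real k - 1) - 6)\<^sup>2 + 4 * (4 * real k - 11)"
        unfolding TD by (simp add: power2_eq_square algebra_simps)
      then show ?thesis using k3 by simp
    qed
    have s2: "s\<^sup>2 = T\<^sup>2 - 4 * D" unfolding s_def using disc by simp
    have s0: "s \<ge> 0" unfolding s_def using disc by simp
    have 1: "(real n)\<^sup>2 - 4 * real n + 11 = 4 * T" unfolding k TD by (simp add: power2_eq_square algebra_simps)
    have 2: "64 * (real n - 2) * (real n - 4) = 16 * (4 * D)" unfolding k TD by (simp add: algebra_simps)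
    have 3: "(4 * T)\<^sup>2 - 16 * (4 * D) = 16 * (T\<^sup>2 - 4 * D)" by (simp add: power2_eq_square algebra_simps)
    have "sqrt (16 * (T\<^sup>2 - 4 * D)) = 4 * s" unfolding s_def real_sqrt_mult by simp
    then have B: "extremal_radius n = sqrt ((T + s) / 2)" 
      using False unfolding extremal_radius_def 1 2 3 by simp
    have T: "T > 0" unfolding TD using k3 by (intro add_nonneg_pos) auto
    have pos: "extremal_radius n > 0" unfolding B using T s0 by simp
    have t: "t = (T + s) / 2" unfolding t_def B using T s0 by simp
    have root: "t\<^sup>2 - T * t + D = 0" unfolding t using s2 by (simp add: power2_eq_square field_simps)
    have half: "2 * t \<ge> T" using t s0 by simp
    have "real R0 * real S0 + 2 = T" "(2 * real R0 - 1) * (2 * real S0 - 1) = D"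
      unfolding R0 TD by (simp_all add: algebra_simps)
    then show ?thesis using pos root half by (simp only:)
  qed
  then show "extremal_radius n > 0"
    and "t\<^sup>2 - (real R0 * real S0 + 2) * t + (2 * real R0 - 1) * (2 * real S0 - 1) = 0"
    and "2 * t \<ge> real R0 * real S0 + 2" by blast+
qed

section \<open>Nonnegative eigenvectors of signed bipartite weights\<close>

definition pos_nbrs :: "('a \<Rightarrow> 'a \<Rightarrow> real) \<Rightarrow> 'a set \<Rightarrow> 'a \<Rightarrow> 'a set" where
  "pos_nbrs w S v = {i \<in> S. w v i = 1}"

definition other_nbrs :: "('a \<Rightarrow> 'a \<Rightarrow> real) \<Rightarrow> 'a set \<Rightarrow> 'a \<Rightarrow> 'a \<Rightarrow> 'a set" where
  "other_nbrs w S v u = S - insert u (pos_nbrs w S v)"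

text \<open>
  The upper bound for the weights, with classes \<open>{u1}\<close>, \<open>P\<close>, \<open>A\<close> on one side and \<open>{v1}\<close>, \<open>Q\<close>, \<open>B\<close> on the
  other. Its zero blocks are \<open>u1 B\<close>, \<open>P Q\<close> and \<open>A v1\<close>.
\<close>

definition hexagon_weight :: "('a \<Rightarrow> 'a \<Rightarrow> real) \<Rightarrow> 'a \<Rightarrow> 'a \<Rightarrow> 'a \<Rightarrow> 'a \<Rightarrow> real" where
  "hexagon_weight w u1 v1 i j =
    (if i = u1 then if j = v1 then -1 else if w u1 j = 1 then 1 else 0
     else if j = v1 then if w v1 i = 1 then 1 else 0
     else if w v1 i = 1 \<and> w u1 j = 1 then 0 else 1)"

lemma hexagon_weight_swap: "hexagon_weight w v1 u1 j i = hexagon_weight w u1 v1 i j"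
  by (auto simp: hexagon_weight_def)

text \<open>Weights on pairs stand for the graph after switching, and the assumptions are symmetric
  in \<open>X\<close> and \<open>Y\<close>, so every result also holds with the parts exchanged.
  Unbalance appears as the absence of a switching to nonnegative weights, without reference to
  cycles.\<close>

locale nonneg_eigenvector =
  fixes X Y :: "'a set" and w :: "'a \<Rightarrow> 'a \<Rightarrow> real" and z :: "'a \<Rightarrow> real" and \<sigma> :: real
  assumes finite: "finite X" "finite Y" and disjoint: "X \<inter> Y = {}"
    and w_sym: "w u v = w v u"
    and w_values: "w u v \<in> {-1, 0, 1}"
    and four_cycles: "\<lbrakk>x \<in> X; x' \<in> X; y \<in> Y; y' \<in> Y; x \<noteq> x'; y \<noteq> y'\<rbrakk> \<Longrightarrow>
      w x y * w x y' * w x' y * w x' y' \<ge> 0"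
    and nonneg: "z u \<ge> 0"
    and eigen_X: "x \<in> X \<Longrightarrow> (\<Sum>y\<in>Y. w x y * z y) = \<sigma> * z x"
    and eigen_Y: "y \<in> Y \<Longrightarrow> (\<Sum>x\<in>X. w y x * z x) = \<sigma> * z y"
    and \<sigma>_pos: "\<sigma> > 0"
    and nonzero: "\<exists>u\<in>X \<union> Y. z u \<noteq> 0"
    and neg_imp_pos_X: "\<lbrakk>x \<in> X; y \<in> Y; w x y = -1\<rbrakk> \<Longrightarrow> \<exists>y\<in>Y. w x y = 1"
    and neg_imp_pos_Y: "\<lbrakk>x \<in> X; y \<in> Y; w x y = -1\<rbrakk> \<Longrightarrow> \<exists>x\<in>X. w x y = 1"
    and unbalanced_weight: "\<not> (\<exists>s. (\<forall>u\<in>X \<union> Y. s u \<in> {-1, 1}) \<and> (\<forall>x\<in>X. \<forall>y\<in>Y. s x * s y * w x y \<ge> 0))"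
begin

lemma swap_parts: "nonneg_eigenvector Y X w z \<sigma>"
proof
  fix x x' y y' assume "x \<in> Y" "x' \<in> Y" "y \<in> X" "y' \<in> X" "x \<noteq> x'" "y \<noteq> y'"
  then have "w y x * w y x' * w y' x * w y' x' \<ge> 0" by (intro four_cycles) auto
  then show "w x y * w x y' * w x' y * w x' y' \<ge> 0" by (simp add: w_sym mult.commute mult.left_commute)
next
  show "\<not> (\<exists>s. (\<forall>u\<in>Y \<union> X. s u \<in> {-1, 1}) \<and> (\<forall>x\<in>Y. \<forall>y\<in>X. s x * s y * w x y \<ge> 0))"
  proof
    assume "\<exists>s. (\<forall>u\<in>Y \<union> X. s u \<in> {-1, 1}) \<and> (\<forall>x\<in>Y. \<forall>y\<in>X. s x * s y * w x y \<ge> 0)"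
    then obtain s where s: "\<forall>u\<in>Y \<union> X. s u \<in> {-1, 1}" "\<forall>x\<in>Y. \<forall>y\<in>X. s x * s y * w x y \<ge> 0" by blast
    have "s x * s y * w x y \<ge> 0" if "x \<in> X" "y \<in> Y" for x y
    proof -
      have "s y * s x * w y x \<ge> 0" using s(2) that by blast
      then show ?thesis by (simp add: w_sym[of x y] mult.commute)
    qed
    then show False using unbalanced_weight s(1) by blast
  qed
next
  fix x y assume *: "x \<in> Y" "y \<in> X" "w x y = -1"
  then have neg: "w y x = -1" by (simp add: w_sym[of y])
  show "\<exists>y\<in>X. w x y = 1"
    using neg_imp_pos_Y[OF *(2,1) neg] by (simp add: w_sym[of x])
  show "\<exists>x\<in>Y. w x y = 1"
    using neg_imp_pos_X[OF *(2,1) neg] by (simp add: w_sym[of y])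
next
  show "Y \<inter> X = {}" using disjoint by blast
  show "\<exists>u\<in>Y \<union> X. z u \<noteq> 0" using nonzero by blast
qed (fact finite w_sym w_values nonneg eigen_X eigen_Y \<sigma>_pos)+

lemma negative_edge_exists: "\<exists>x\<in>X. \<exists>y\<in>Y. w x y = -1"
proof (rule ccontr)
  assume "\<not> ?thesis"
  then have "w x y \<ge> 0" if "x \<in> X" "y \<in> Y" for x y
    using w_values[of x y] that by auto
  then have "\<exists>s. (\<forall>u\<in>X \<union> Y. s u \<in> {-1, 1}) \<and> (\<forall>x\<in>X. \<forall>y\<in>Y. s x * s y * w x y \<ge> 0)"
    by (intro exI[of _ "\<lambda>_. 1"]) simp
  then show False using unbalanced_weight by blast
qed

text \<open>Multiplied by \<open>\<sigma>\<close>, both sides are the bilinear form of the weights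
  at \<open>z\<close>, summed by rows or by columns. This lets row bounds on \<open>X\<close> be
  measured against the norm on \<open>Y\<close>.\<close>

lemma sum_squares_eq: "(\<Sum>x\<in>X. (z x)\<^sup>2) = (\<Sum>y\<in>Y. (z y)\<^sup>2)"
proof -
  have "\<sigma> * (\<Sum>x\<in>X. (z x)\<^sup>2) = (\<Sum>x\<in>X. z x * (\<sigma> * z x))"
    by (simp add: sum_distrib_left power2_eq_square mult_ac)
  also have "\<dots> = (\<Sum>x\<in>X. z x * (\<Sum>y\<in>Y. w x y * z y))"
    by (intro sum.cong) (simp_all add: eigen_X)
  also have "\<dots> = (\<Sum>x\<in>X. \<Sum>y\<in>Y. z x * (w x y * z y))"
    by (simp add: sum_distrib_left)
  also have "\<dots> = (\<Sum>y\<in>Y. \<Sum>x\<in>X. z x * (w x y * z y))"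
    by (rule sum.swap)
  also have "\<dots> = (\<Sum>y\<in>Y. z y * (\<Sum>x\<in>X. w y x * z x))"
    unfolding sum_distrib_left by (intro sum.cong refl) (metis w_sym mult.commute mult.left_commute)
  also have "\<dots> = (\<Sum>y\<in>Y. z y * (\<sigma> * z y))"
    by (intro sum.cong) (simp_all add: eigen_Y)
  also have "\<dots> = \<sigma> * (\<Sum>y\<in>Y. (z y)\<^sup>2)"
    by (simp add: sum_distrib_left power2_eq_square mult_ac)
  finally show ?thesis using \<sigma>_pos by simp
qed

lemma sum_squares_pos: "(\<Sum>y\<in>Y. (z y)\<^sup>2) > 0"
proof -
  have "(\<Sum>u\<in>X \<union> Y. (z u)\<^sup>2) > 0"
    using nonzero finite by (smt (verit) finite_UnI sum_pos2 zero_le_power2 zero_less_power2)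
  moreover have "(\<Sum>u\<in>X \<union> Y. (z u)\<^sup>2) = (\<Sum>x\<in>X. (z x)\<^sup>2) + (\<Sum>y\<in>Y. (z y)\<^sup>2)"
    using finite disjoint by (intro sum.union_disjoint)
  ultimately show ?thesis using sum_squares_eq by simp
qed

end

section \<open>The six classes around a negative edge\<close>

locale negative_edge = nonneg_eigenvector +
  fixes u1 v1
  assumes u1: "u1 \<in> X" and v1: "v1 \<in> Y" and neg: "w u1 v1 = -1"
begin

lemma swap_edge: "negative_edge Y X w z \<sigma> v1 u1"
  using swap_parts u1 v1 neg w_sym[of v1 u1] by (simp add: negative_edge_def negative_edge_axioms_def)

abbreviation P where "P \<equiv> pos_nbrs w X v1"
abbreviation Q where "Q \<equiv> pos_nbrs w Y u1"
abbreviation A where "A \<equiv> other_nbrs w X v1 u1"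
abbreviation B where "B \<equiv> other_nbrs w Y u1 v1"
abbreviation m where "m \<equiv> hexagon_weight w u1 v1"

lemma mem_P: "i \<in> P \<longleftrightarrow> i \<in> X \<and> w i v1 = 1"
  by (auto simp: pos_nbrs_def w_sym[of v1])

lemma mem_Q: "j \<in> Q \<longleftrightarrow> j \<in> Y \<and> w u1 j = 1"
  by (auto simp: pos_nbrs_def)

lemma mem_A: "i \<in> A \<longleftrightarrow> i \<in> X \<and> i \<noteq> u1 \<and> w i v1 \<noteq> 1"
  by (auto simp: other_nbrs_def mem_P)

lemma mem_B: "j \<in> B \<longleftrightarrow> j \<in> Y \<and> j \<noteq> v1 \<and> w u1 j \<noteq> 1"
  by (auto simp: other_nbrs_def mem_Q)

lemma P_nonempty: "P \<noteq> {}"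
  using neg_imp_pos_Y[OF u1 v1 neg] mem_P by blast

text \<open>If \<open>A\<close> were empty, switching in \<open>{u1} \<union> Q\<close> would make every edge positive.\<close>

lemma A_nonempty: "A \<noteq> {}"
proof
  assume "A = {}"
  then have P: "w i v1 = 1" if "i \<in> X" "i \<noteq> u1" for i
    using that mem_A by blast
  define s where "s u = (if u \<in> insert u1 Q then -1 else 1 :: real)" for u
  have "s i * s j * w i j \<ge> 0" if i: "i \<in> X" and j: "j \<in> Y" for i j
  proof (cases "i = u1")
    case True
    have "j \<noteq> u1" using disjoint u1 j by blast
    then show ?thesis using True j w_values[of u1 j] by (auto simp: s_def mem_Q)
  next
    case False
    then have si: "s i = 1" using i disjoint by (auto simp: s_def mem_Q)
    have ju: "j \<noteq> u1" using disjoint u1 j by blast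
    show ?thesis
    proof (cases "j \<in> Q")
      case True
      then have "w u1 j = 1" "j \<noteq> v1" using neg by (auto simp: mem_Q)
      then have "w i j \<le> 0"
        using four_cycles[OF i u1 v1 j False] P[OF i False] neg by simp
      then show ?thesis using si True by (simp add: s_def)
    next
      case notQ: False
      then have sj: "s j = 1" using ju by (simp add: s_def)
      have "w i j \<noteq> -1"
      proof
        assume neg_ij: "w i j = -1"
        then have jv: "j \<noteq> v1" using P[OF i False] by auto
        \<comment> \<open>A vertex on a negative edge has a positive edge too; \<open>i'\<close>
          closes a 4-cycle through \<open>i\<close>, \<open>v1\<close>, \<open>i'\<close>,
          \<open>j\<close> whose only negative edge is \<open>i j\<close>.\<close>
        obtain i' where i': "i' \<in> X" "w i' j = 1" using neg_imp_pos_Y[OF i j neg_ij] by blast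
        have "i' \<noteq> u1" using i' notQ j by (auto simp: mem_Q)
        moreover have "i' \<noteq> i" using i'(2) neg_ij by auto
        ultimately show False
          using four_cycles[OF i i'(1) v1 j] P[OF i False] P[OF i'(1)] i'(2) neg_ij jv by simp
      qed
      then show ?thesis using w_values[of i j] si sj by auto
    qed
  qed
  moreover have "s u \<in> {-1, 1}" for u by (simp add: s_def)
  ultimately show False using unbalanced_weight by blast
qed

lemma Q_nonempty: "Q \<noteq> {}"
  using negative_edge.P_nonempty[OF swap_edge] .

lemma B_nonempty: "B \<noteq> {}"
  using negative_edge.A_nonempty[OF swap_edge] .

lemma X_partition: "X = insert u1 (P \<union> A)" "u1 \<notin> P \<union> A" "P \<inter> A = {}" "finite P" "finite A"
  using u1 neg finite w_sym[of v1 u1] by (auto simp: mem_P mem_A pos_nbrs_def other_nbrs_def)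

lemma Y_partition: "Y = insert v1 (Q \<union> B)" "v1 \<notin> Q \<union> B" "Q \<inter> B = {}" "finite Q" "finite B"
  using v1 neg finite by (auto simp: mem_Q mem_B pos_nbrs_def other_nbrs_def)

lemma sum_X: "(\<Sum>i\<in>X. f i) = f u1 + (\<Sum>i\<in>P. f i) + (\<Sum>i\<in>A. f i)" for f :: "'a \<Rightarrow> real"
  by (subst X_partition(1)) (use X_partition(2-) in \<open>simp add: sum.union_disjoint\<close>)

lemma sum_Y: "(\<Sum>i\<in>Y. f i) = f v1 + (\<Sum>i\<in>Q. f i) + (\<Sum>i\<in>B. f i)" for f :: "'a \<Rightarrow> real"
  by (subst Y_partition(1)) (use Y_partition(2-) in \<open>simp add: sum.union_disjoint\<close>)

lemma card_X: "card X = 1 + card P + card A"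
  by (subst X_partition(1)) (use X_partition(2-) in \<open>simp add: card_Un_disjoint\<close>)

lemma card_Y: "card Y = 1 + card Q + card B"
  by (subst Y_partition(1)) (use Y_partition(2-) in \<open>simp add: card_Un_disjoint\<close>)

lemma cards_ge_1: "card P \<ge> 1" "card A \<ge> 1" "card Q \<ge> 1" "card B \<ge> 1"
  using P_nonempty A_nonempty Q_nonempty B_nonempty X_partition(4,5) Y_partition(4,5)
  by (simp_all add: Suc_le_eq card_gt_0_iff)

text \<open>Only the block of \<open>P\<close> and \<open>Q\<close> needs an argument: a positive
  edge there would close a negative 4-cycle through \<open>u1\<close> and \<open>v1\<close>. On the
  other blocks the definitions of the classes suffice.\<close>

lemma weight_le_hexagon: 
  assumes i: "i \<in> X" and j: "j \<in> Y"
  shows "w i j \<le> m i j"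
proof (cases "i \<in> P \<and> j \<in> Q")
  case True
  then have "i \<noteq> u1" "j \<noteq> v1" "w i v1 = 1" "w u1 j = 1" using neg by (auto simp: mem_P mem_Q)
  moreover from this have "w i j \<le> 0"
    using four_cycles[OF i u1 v1 j] neg by simp
  ultimately show ?thesis by (simp add: hexagon_weight_def w_sym[of v1])
next
  case False
  then show ?thesis using w_values[of i j] neg i j
    by (auto simp: hexagon_weight_def mem_P mem_Q w_sym[of v1])
qed

definition row_bound where "row_bound i = (\<Sum>j\<in>Y. m i j * z j)"
definition row_u1 where "row_u1 = (\<Sum>j\<in>Q. z j) - z v1"
definition row_P where "row_P = (\<Sum>j\<in>B. z j) + z v1"

lemma hexagon_rows:
  shows "row_bound u1 = row_u1" and "i \<in> P \<Longrightarrow> row_bound i = row_P" and "i \<in> A \<Longrightarrow> row_bound i = row_u1 + row_P"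
proof -
  have Q: "j \<in> Q \<Longrightarrow> j \<noteq> v1 \<and> w u1 j = 1" and B: "j \<in> B \<Longrightarrow> j \<noteq> v1 \<and> w u1 j \<noteq> 1" for j
    using neg by (auto simp: mem_Q mem_B)
  show "row_bound u1 = row_u1" unfolding row_bound_def row_u1_def sum_Y by (simp add: hexagon_weight_def Q B)
  show "row_bound i = row_P" if "i \<in> P"
  proof -
    have "i \<noteq> u1" "w v1 i = 1" using that neg by (auto simp: mem_P w_sym[of v1])
    then show ?thesis unfolding row_bound_def row_P_def sum_Y by (simp add: hexagon_weight_def Q B)
  qed
  show "row_bound i = row_u1 + row_P" if "i \<in> A"
  proof -
    have "i \<noteq> u1" "w v1 i \<noteq> 1" using that neg by (auto simp: mem_A w_sym[of v1])
    then show ?thesis unfolding row_bound_def row_u1_def row_P_def sum_Y by (simp add: hexagon_weight_def Q B)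
  qed
qed

lemma eigen_le: "i \<in> X \<Longrightarrow> \<sigma> * z i \<le> row_bound i"
  unfolding row_bound_def eigen_X[symmetric] 
  by (intro sum_mono mult_right_mono weight_le_hexagon nonneg)

lemma sum_row_bound_squares: "(\<Sum>i\<in>X. (row_bound i)\<^sup>2) = row_u1\<^sup>2 + card P * row_P\<^sup>2 + card A * (row_u1 + row_P)\<^sup>2"
  unfolding sum_X by (simp add: hexagon_rows)

lemma sum_eigen_le: "\<sigma>\<^sup>2 * (\<Sum>y\<in>Y. (z y)\<^sup>2) \<le> (\<Sum>i\<in>X. (row_bound i)\<^sup>2)"
proof -
  have "\<sigma>\<^sup>2 * (\<Sum>x\<in>X. (z x)\<^sup>2) = (\<Sum>x\<in>X. (\<sigma> * z x)\<^sup>2)"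
    by (simp add: sum_distrib_left power_mult_distrib)
  also have "\<dots> \<le> (\<Sum>i\<in>X. (row_bound i)\<^sup>2)"
    using eigen_le nonneg \<sigma>_pos by (intro sum_mono power_mono) auto
  finally show ?thesis unfolding sum_squares_eq .
qed

text \<open>The trace of \<open>M M^T\<close>, which is the number of nonzero entries of
  \<open>M\<close> as these are all 1 or -1.\<close>

definition hexagon_trace where "hexagon_trace = real (card X - 1) * real (card Y - 1) + 2 - (real (card P) - 1) * (real (card Q) - 1)"
text \<open>The sum of the squared 2x2 minors of \<open>M\<close>; since \<open>M\<close> factors
  through dimension two, it is the product of two Gram determinants, those of \<open>G\<close> and
  \<open>H\<close> above.\<close>

definition hexagon_minors where "hexagon_minors = (real (card A) * card P + real (card X - 1)) * (real (card B) * card Q + real (card Y - 1))"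

text \<open>The rows see \<open>z\<close> on \<open>Q\<close> and \<open>B\<close> only through its
  sums; Cauchy-Schwarz inside each of these classes bounds the norm below in terms of them.\<close>

lemma hexagon_bound:
  assumes t: "2 * t \<ge> hexagon_trace"
    and det: "t\<^sup>2 - hexagon_trace * t + hexagon_minors \<ge> 0"
  shows "(\<Sum>i\<in>X. (row_bound i)\<^sup>2) \<le> t * (\<Sum>y\<in>Y. (z y)\<^sup>2)"
    and "t\<^sup>2 - hexagon_trace * t + hexagon_minors > 0 \<Longrightarrow> (\<Sum>i\<in>X. (row_bound i)\<^sup>2) < t * (\<Sum>y\<in>Y. (z y)\<^sup>2)"
proof -
  let ?N = "\<Sum>y\<in>Y. (z y)\<^sup>2"
  have cs: "(\<Sum>j\<in>S. z j)\<^sup>2 / card S \<le> (\<Sum>j\<in>S. (z j)\<^sup>2)" if "card S \<ge> 1" for S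
    using sum_squared_le_sum_of_squares[of z S] that by (simp add: divide_le_eq mult.commute)
  have N: "?N \<ge> (z v1)\<^sup>2 + (\<Sum>j\<in>Q. z j)\<^sup>2 / card Q + (\<Sum>j\<in>B. z j)\<^sup>2 / card B"
    unfolding sum_Y using cs[OF cards_ge_1(3)] cs[OF cards_ge_1(4)] by linarith
  have ge: "real (card P) \<ge> 1" "real (card A) \<ge> 1" "real (card Q) \<ge> 1" "real (card B) \<ge> 1"
    using cards_ge_1 by simp_all
  have RS: "real (card X - 1) = real (card P) + real (card A)"
    "real (card Y - 1) = real (card Q) + real (card B)"
    by (simp_all add: card_X card_Y)
  note * = hexagon_form_bound[OF ge RS t[unfolded hexagon_trace_def] N, folded row_u1_def row_P_def hexagon_trace_def hexagon_minors_def, folded sum_row_bound_squares]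
  show "(\<Sum>i\<in>X. (row_bound i)\<^sup>2) \<le> t * ?N" using *(1) det by blast
  show "t\<^sup>2 - hexagon_trace * t + hexagon_minors > 0 \<Longrightarrow> (\<Sum>i\<in>X. (row_bound i)\<^sup>2) < t * ?N" using *(2) det sum_squares_pos by blast
qed

section \<open>The case of equality in the hexagon bound\<close>

text \<open>At \<open>t = \<sigma>\<^sup>2\<close> the inequalities form a circle: the squares of
  \<open>\<sigma> * z i\<close> sum to at most those of \<open>row_bound i\<close>, which sum to at
  most \<open>\<sigma>\<^sup>2\<close> times the norm, the first sum again. So equality holds term
  by term.\<close>

lemma equality_rows:
  assumes "2 * \<sigma>\<^sup>2 \<ge> hexagon_trace" "(\<sigma>\<^sup>2)\<^sup>2 - hexagon_trace * \<sigma>\<^sup>2 + hexagon_minors \<ge> 0" and i: "i \<in> X"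
  shows "row_bound i = \<sigma> * z i"
proof -
  have le: "(\<sigma> * z k)\<^sup>2 \<le> (row_bound k)\<^sup>2" if "k \<in> X" for k
    using eigen_le[OF that] nonneg \<sigma>_pos by (intro power_mono) auto
  have "(\<Sum>i\<in>X. (\<sigma> * z i)\<^sup>2) = (\<Sum>i\<in>X. (row_bound i)\<^sup>2)"
    using hexagon_bound(1)[OF assms(1,2)] sum_eigen_le sum_squares_eq
    by (simp add: sum_distrib_left[symmetric] power_mult_distrib)
  then have "(\<sigma> * z i)\<^sup>2 = (row_bound i)\<^sup>2"
    using sum_mono_inv[of "\<lambda>i. (\<sigma> * z i)\<^sup>2" X "\<lambda>i. (row_bound i)\<^sup>2" i] le i finite by blast
  then show ?thesis
    using eigen_le[OF i] nonneg[of i] \<sigma>_pos 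
    by (metis mult_nonneg_nonneg order_less_imp_le order_trans power2_eq_imp_eq)
qed

text \<open>\<open>z u1\<close> can vanish, as in the negative hexagon itself. On \<open>P\<close>
  and \<open>A\<close>, \<open>\<sigma> * z\<close> equals \<open>row_P\<close> and
  \<open>row_u1 + row_P\<close>, so \<open>row_P > 0\<close> is the point. If it were 0,
  \<open>z\<close> would vanish on \<open>P\<close>, the equality at \<open>v1\<close> with the
  parts exchanged would read \<open>\<sigma> * z v1 = - z u1\<close>, and then \<open>z\<close>
  would vanish on all of \<open>X\<close>.\<close>

lemma equality_pos:
  assumes half: "2 * \<sigma>\<^sup>2 \<ge> hexagon_trace" and det: "(\<sigma>\<^sup>2)\<^sup>2 - hexagon_trace * \<sigma>\<^sup>2 + hexagon_minors \<ge> 0"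
    and i: "i \<in> X" "i \<noteq> u1"
  shows "z i > 0"
proof -
  interpret flip: negative_edge Y X w z \<sigma> v1 u1 by (rule swap_edge)
  have flip_eq: "flip.hexagon_trace = hexagon_trace" "flip.hexagon_minors = hexagon_minors"
    by (simp_all add: flip.hexagon_trace_def hexagon_trace_def flip.hexagon_minors_def hexagon_minors_def mult.commute)
  note rows = equality_rows[OF half det]
  have zP: "\<sigma> * z k = row_P" if "k \<in> P" for k
    using rows[of k] hexagon_rows(2)[OF that] that by (simp add: mem_P)
  have zu: "\<sigma> * z u1 = row_u1"
    using rows[OF u1] hexagon_rows(1) by simp
  have zA: "\<sigma> * z k = row_u1 + row_P" if "k \<in> A" for k
    using rows[of k] hexagon_rows(3)[OF that] that by (simp add: mem_A)
  obtain k where k: "k \<in> P" using P_nonempty by blast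
  have fg: "row_u1 \<ge> 0" "row_P \<ge> 0"
    using zP[OF k] zu nonneg \<sigma>_pos by (metis mult_nonneg_nonneg order_less_imp_le)+
  have fg_pos: "row_u1 + row_P > 0"
  proof (rule ccontr)
    assume "\<not> row_u1 + row_P > 0"
    then have "row_u1 = 0" "row_P = 0" using fg by auto
    then have "z k = 0" if "k \<in> X" for k
    proof -
      have "k = u1 \<or> k \<in> P \<or> k \<in> A" using that X_partition(1) by blast
      then show ?thesis using zP zA zu \<sigma>_pos \<open>row_u1 = 0\<close> \<open>row_P = 0\<close> by auto
    qed
    then show False using sum_squares_pos sum_squares_eq by simp
  qed
  have "row_P > 0"
  proof (rule ccontr)
    assume "\<not> row_P > 0"
    then have row_P: "row_P = 0" using fg by simp
    then have "z k = 0" if "k \<in> P" for k using zP[OF that] \<sigma>_pos by simp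
    then have "flip.row_u1 = - z u1" by (simp add: flip.row_u1_def)
    moreover have "\<sigma> * z v1 = flip.row_u1"
      using flip.equality_rows[of v1] v1 half det flip.hexagon_rows(1) by (simp add: flip_eq)
    ultimately have "z u1 \<le> 0" using nonneg[of v1] \<sigma>_pos by (smt (verit) mult_nonneg_nonneg)
    then have "z u1 = 0" using nonneg[of u1] by simp
    then show False using zu row_P fg_pos by simp
  qed
  moreover have "i \<in> P \<or> i \<in> A" using i X_partition(1) by blast
  ultimately have "\<sigma> * z i > 0" using zP zA fg_pos by auto
  then show ?thesis using \<sigma>_pos by (simp add: zero_less_mult_iff)
qed

text \<open>The gaps \<open>m i j - w i j\<close> are nonnegative and, weighted by
  \<open>z j\<close>, sum to zero along a row.\<close>

lemma equality_weight_aux: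
  assumes "2 * \<sigma>\<^sup>2 \<ge> hexagon_trace" "(\<sigma>\<^sup>2)\<^sup>2 - hexagon_trace * \<sigma>\<^sup>2 + hexagon_minors \<ge> 0"
    and i: "i \<in> X" and j: "j \<in> Y" "z j > 0"
  shows "w i j = m i j"
proof -
  have "(\<Sum>j\<in>Y. (m i j - w i j) * z j) = row_bound i - \<sigma> * z i"
    unfolding row_bound_def eigen_X[OF i, symmetric] by (simp add: left_diff_distrib sum_subtractf)
  also have "\<dots> = 0" using equality_rows[OF assms(1,2) i] by simp
  finally have "(m i j - w i j) * z j = 0"
    using sum_nonneg_eq_0_iff[of Y "\<lambda>j. (m i j - w i j) * z j"] finite weight_le_hexagon[OF i] nonneg j by auto
  then show ?thesis using j by simp
qed

text \<open>Rows settle every column except possibly \<open>v1\<close>, and the exchanged version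
  every row except possibly \<open>u1\<close>; the one entry left is the chosen negative
  edge.\<close>

lemma equality_weight:
  assumes half: "2 * \<sigma>\<^sup>2 \<ge> hexagon_trace" and det: "(\<sigma>\<^sup>2)\<^sup>2 - hexagon_trace * \<sigma>\<^sup>2 + hexagon_minors \<ge> 0"
    and i: "i \<in> X" and j: "j \<in> Y"
  shows "w i j = m i j"
proof -
  interpret flip: negative_edge Y X w z \<sigma> v1 u1 by (rule swap_edge)
  have flip_eq: "flip.hexagon_trace = hexagon_trace" "flip.hexagon_minors = hexagon_minors"
    by (simp_all add: flip.hexagon_trace_def hexagon_trace_def flip.hexagon_minors_def hexagon_minors_def mult.commute)
  consider "j \<noteq> v1" | "i \<noteq> u1" | "i = u1" "j = v1" by blast
  then show ?thesis
  proof cases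
    case 1
    then have "z j > 0" using flip.equality_pos[of j] half det j by (simp add: flip_eq)
    then show ?thesis using equality_weight_aux[OF half det i j] by simp
  next
    case 2
    then have "z i > 0" using equality_pos[OF half det i] by simp
    then have "w j i = flip.m j i" using flip.equality_weight_aux[of j i] half det i j by (simp add: flip_eq)
    then show ?thesis by (simp add: w_sym[of i j] hexagon_weight_swap)
  next
    case 3
    then show ?thesis using neg by (simp add: hexagon_weight_def)
  qed
qed

end

section \<open>Spectra and balance of signed graphs\<close>

definition sg_weight :: "'a signed_graph \<Rightarrow> 'a \<Rightarrow> 'a \<Rightarrow> real" where
  "sg_weight \<Gamma> u v = (if (u, v) \<in> sarcs \<Gamma> then real_of_int (esign \<Gamma> u v) else 0)"

lemma signed_graphD:
  assumes "signed_graph \<Gamma>"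
  shows "finite (sverts \<Gamma>)"
    and "(u, v) \<in> sarcs \<Gamma> \<Longrightarrow> u \<in> sverts \<Gamma> \<and> v \<in> sverts \<Gamma> \<and> u \<noteq> v \<and> (v, u) \<in> sarcs \<Gamma> \<and> esign \<Gamma> u v \<in> {-1, 1}"
proof -
  interpret pair_graph "fst \<Gamma>" using assms by (simp add: signed_graph_def)
  show "finite (sverts \<Gamma>)" by (rule pair_finite_verts)
  assume uv: "(u, v) \<in> sarcs \<Gamma>"
  then have "(v, u) \<in> sarcs \<Gamma>" by (rule arcs_symmetric)
  then show "u \<in> sverts \<Gamma> \<and> v \<in> sverts \<Gamma> \<and> u \<noteq> v \<and> (v, u) \<in> sarcs \<Gamma> \<and> esign \<Gamma> u v \<in> {-1, 1}"
    using uv in_arcsD1[OF uv] in_arcsD2[OF uv] pair_no_loops[OF uv] assms by (auto simp: signed_graph_def)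
qed

lemma sg_weight_sym: "signed_graph \<Gamma> \<Longrightarrow> sg_weight \<Gamma> u v = sg_weight \<Gamma> v u"
  using signed_graphD(2)[of \<Gamma> u v] signed_graphD(2)[of \<Gamma> v u] by (auto simp: sg_weight_def insert_commute)

lemma sg_weight_values: "signed_graph \<Gamma> \<Longrightarrow> sg_weight \<Gamma> u v \<in> {-1, 0, 1}"
  using signed_graphD(2)[of \<Gamma> u v] by (auto simp: sg_weight_def)

section \<open>Spectral radius and real eigenvectors\<close>

lemma spectral_radius_ge_eigenvalue:
  assumes "signed_graph \<Gamma>" and u: "u \<in> sverts \<Gamma>" "x u \<noteq> 0"
    and eig: "\<And>u. u \<in> sverts \<Gamma> \<Longrightarrow> (\<Sum>v\<in>sverts \<Gamma>. sg_weight \<Gamma> u v * x v) = k * x u"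
  shows "\<bar>k\<bar> \<le> sg_spectral_radius \<Gamma>"
proof -
  obtain vs where vs: "set vs = sverts \<Gamma>" "distinct vs"
    using signed_graphD(1)[OF assms(1)] finite_distinct_list by blast
  let ?A = "adjacency_mat vs \<Gamma> :: complex mat"
  have A: "?A \<in> carrier_mat (length vs) (length vs)" by (simp add: adjacency_mat_def)
  have "(\<Sum>v\<in>sverts \<Gamma>. (if (u, v) \<in> sarcs \<Gamma> then of_int (esign \<Gamma> u v) else 0) * complex_of_real (x v))
     = complex_of_real k * complex_of_real (x u)" if "u \<in> sverts \<Gamma>" for u
  proof -
    have "(\<Sum>v\<in>sverts \<Gamma>. (if (u, v) \<in> sarcs \<Gamma> then of_int (esign \<Gamma> u v) else 0) * complex_of_real (x v))
      = complex_of_real (\<Sum>v\<in>sverts \<Gamma>. sg_weight \<Gamma> u v * x v)"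
      unfolding of_real_sum by (intro sum.cong) (auto simp: sg_weight_def)
    then show ?thesis using eig[OF that] by simp
  qed
  then have "eigenvalue ?A (complex_of_real k)"
    unfolding eigenvalue_adjacency_mat_iff[OF vs(2,1)] using u
    by (intro exI[of _ "\<lambda>v. complex_of_real (x v)"]) auto
  then have "norm (complex_of_real k) \<in> norm ` spectrum ?A"
    unfolding spectrum_def by blast
  moreover have "length vs > 0" using u vs(1) by (cases vs) auto
  ultimately have "norm (complex_of_real k) \<le> spectral_radius ?A"
    using spectral_radius_mem_max(2)[OF A] by blast
  then show ?thesis using sg_spectral_radius_eq[OF vs(2,1)] by simp
qed

text \<open>The weights are real and symmetric, so the Hermitian form \<open>F\<close> at a complex
  eigenvector equals its conjugate and the eigenvalue is real. Then the real and imaginary parts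
  satisfy the same equation, and one of them is nonzero.\<close>

lemma spectral_radius_real_eigenvector:
  assumes \<Gamma>: "signed_graph \<Gamma>" and ne: "sverts \<Gamma> \<noteq> {}"
  obtains k :: real and x :: "'a \<Rightarrow> real"
  where "\<bar>k\<bar> = sg_spectral_radius \<Gamma>" and "\<exists>u\<in>sverts \<Gamma>. x u \<noteq> 0"
    and "\<And>u. u \<in> sverts \<Gamma> \<Longrightarrow> (\<Sum>v\<in>sverts \<Gamma>. sg_weight \<Gamma> u v * x v) = k * x u"
proof -
  let ?V = "sverts \<Gamma>"
  let ?a = "\<lambda>u v. complex_of_real (sg_weight \<Gamma> u v)"
  have fin: "finite ?V" using signed_graphD(1)[OF \<Gamma>] .
  obtain vs where vs: "set vs = ?V" "distinct vs"
    using fin finite_distinct_list by blast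
  let ?A = "adjacency_mat vs \<Gamma> :: complex mat"
  have A: "?A \<in> carrier_mat (length vs) (length vs)" by (simp add: adjacency_mat_def)
  have "length vs > 0" using ne vs(1) by (cases vs) auto
  then have "spectral_radius ?A \<in> norm ` spectrum ?A" by (rule spectral_radius_mem_max(1)[OF A])
  then obtain \<kappa> where \<kappa>: "eigenvalue ?A \<kappa>" "norm \<kappa> = sg_spectral_radius \<Gamma>"
    unfolding spectrum_def using sg_spectral_radius_eq[OF vs(2,1)] by auto
  have a: "(if (u, v) \<in> sarcs \<Gamma> then of_int (esign \<Gamma> u v) else 0) = ?a u v" for u v
    by (simp add: sg_weight_def)
  obtain x where x: "\<exists>u\<in>?V. x u \<noteq> 0" "\<And>u. u \<in> ?V \<Longrightarrow> (\<Sum>v\<in>?V. ?a u v * x v) = \<kappa> * x u"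
    using \<kappa>(1)[unfolded eigenvalue_adjacency_mat_iff[OF vs(2,1)] a] by blast
  define N where "N = (\<Sum>u\<in>?V. (cmod (x u))\<^sup>2)"
  have N: "N > 0" unfolding N_def using x(1) fin by (metis (no_types, lifting) sum_pos2 norm_eq_zero zero_le_power2 zero_less_power2)
  define F where "F = (\<Sum>u\<in>?V. \<Sum>v\<in>?V. cnj (x u) * (?a u v * x v))"
  have "F = (\<Sum>u\<in>?V. cnj (x u) * (\<kappa> * x u))"
    unfolding F_def sum_distrib_left[symmetric] by (intro sum.cong) (simp_all add: x(2))
  also have "\<dots> = \<kappa> * complex_of_real N"
    unfolding N_def of_real_sum sum_distrib_left
    by (intro sum.cong refl) (simp add: complex_norm_square[symmetric] mult_ac del: of_real_power)
  finally have F: "F = \<kappa> * complex_of_real N" .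
  have "cnj F = (\<Sum>u\<in>?V. \<Sum>v\<in>?V. x u * (?a u v * cnj (x v)))"
    unfolding F_def by simp
  also have "\<dots> = (\<Sum>v\<in>?V. \<Sum>u\<in>?V. x u * (?a u v * cnj (x v)))" by (rule sum.swap)
  also have "\<dots> = F" unfolding F_def
    by (intro sum.cong refl) (subst sg_weight_sym[OF \<Gamma>], simp add: mult_ac)
  finally have "cnj \<kappa> * complex_of_real N = \<kappa> * complex_of_real N" unfolding F by simp
  then have "cnj \<kappa> = \<kappa>" using N by simp
  then obtain k where k: "\<kappa> = complex_of_real k" using Reals_cnj_iff Reals_cases by metis
  have re: "(\<Sum>v\<in>?V. sg_weight \<Gamma> u v * Re (x v)) = k * Re (x u)"
    and im: "(\<Sum>v\<in>?V. sg_weight \<Gamma> u v * Im (x v)) = k * Im (x u)" if "u \<in> ?V" for u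
    using arg_cong[OF x(2)[OF that], of Re] arg_cong[OF x(2)[OF that], of Im] by (simp_all add: k)
  have "\<bar>k\<bar> = sg_spectral_radius \<Gamma>" using \<kappa>(2) k by simp
  moreover have "(\<exists>u\<in>?V. Re (x u) \<noteq> 0) \<or> (\<exists>u\<in>?V. Im (x u) \<noteq> 0)"
    using x(1) by (auto simp: complex_eq_iff)
  ultimately show ?thesis using that[of k "\<lambda>u. Re (x u)"] that[of k "\<lambda>u. Im (x u)"] re im by blast
qed

definition bipartition :: "'a signed_graph \<Rightarrow> 'a set \<Rightarrow> 'a set \<Rightarrow> bool" where
  "bipartition \<Gamma> X Y \<longleftrightarrow> X \<union> Y = sverts \<Gamma> \<and> X \<inter> Y = {} \<and> sarcs \<Gamma> \<subseteq> X \<times> Y \<union> Y \<times> X"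

lemma bipartition_swap: "bipartition \<Gamma> X Y \<Longrightarrow> bipartition \<Gamma> Y X"
  by (auto simp: bipartition_def)

lemma bipartition_weight:
  assumes "bipartition \<Gamma> X Y" "sg_weight \<Gamma> u v \<noteq> 0"
  shows "u \<in> X \<and> v \<in> Y \<or> u \<in> Y \<and> v \<in> X"
  using assms by (auto simp: bipartition_def sg_weight_def split: if_splits)

lemma bipartite_sum:
  assumes "signed_graph \<Gamma>" "bipartition \<Gamma> X Y" "u \<in> X"
  shows "(\<Sum>v\<in>sverts \<Gamma>. sg_weight \<Gamma> u v * f v) = (\<Sum>v\<in>Y. sg_weight \<Gamma> u v * f v)"
proof (rule sum.mono_neutral_right)
  show "finite (sverts \<Gamma>)" by (rule signed_graphD(1)[OF assms(1)])
  show "Y \<subseteq> sverts \<Gamma>" using assms(2) by (auto simp: bipartition_def)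
  have "u \<notin> Y" using assms(2,3) by (auto simp: bipartition_def)
  then show "\<forall>i\<in>sverts \<Gamma> - Y. sg_weight \<Gamma> u i * f i = 0"
    using bipartition_weight[OF assms(2), of u] by auto
qed

text \<open>Negating an eigenvector on one part negates its eigenvalue, so the sign of the
  eigenvalue can be chosen.\<close>

lemma bipartite_eigenvector:
  assumes \<Gamma>: "signed_graph \<Gamma>" and ne: "sverts \<Gamma> \<noteq> {}" and bip: "bipartition \<Gamma> X Y"
  obtains x :: "'a \<Rightarrow> real" where "\<exists>u\<in>sverts \<Gamma>. x u \<noteq> 0"
    and "\<And>u. u \<in> sverts \<Gamma> \<Longrightarrow> (\<Sum>v\<in>sverts \<Gamma>. sg_weight \<Gamma> u v * x v) = sg_spectral_radius \<Gamma> * x u"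
proof -
  obtain k x where k: "\<bar>k\<bar> = sg_spectral_radius \<Gamma>" and x: "\<exists>u\<in>sverts \<Gamma>. x u \<noteq> 0"
    "\<And>u. u \<in> sverts \<Gamma> \<Longrightarrow> (\<Sum>v\<in>sverts \<Gamma>. sg_weight \<Gamma> u v * x v) = k * x u"
    by (rule spectral_radius_real_eigenvector[OF \<Gamma> ne]) blast
  show ?thesis
  proof (cases "k \<ge> 0")
    case True
    then show ?thesis using that[of x] x k by simp
  next
    case False
    define x' where "x' u = (if u \<in> X then x u else - x u)" for u
    have disj: "X \<inter> Y = {}" "X \<union> Y = sverts \<Gamma>" using bip by (auto simp: bipartition_def)
    have "(\<Sum>v\<in>sverts \<Gamma>. sg_weight \<Gamma> u v * x' v) = - k * x' u" if u: "u \<in> sverts \<Gamma>" for u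
    proof (cases "u \<in> X")
      case True
      have "(\<Sum>v\<in>Y. sg_weight \<Gamma> u v * x' v) = - (\<Sum>v\<in>Y. sg_weight \<Gamma> u v * x v)"
        unfolding sum_negf[symmetric] using disj by (intro sum.cong) (auto simp: x'_def)
      then show ?thesis using x(2)[OF u] True
        by (simp add: bipartite_sum[OF \<Gamma> bip True] x'_def)
    next
      case False
      then have Y: "u \<in> Y" using u disj by auto
      have "(\<Sum>v\<in>X. sg_weight \<Gamma> u v * x' v) = (\<Sum>v\<in>X. sg_weight \<Gamma> u v * x v)"
        by (intro sum.cong) (auto simp: x'_def)
      then show ?thesis using x(2)[OF u] False
        by (simp add: bipartite_sum[OF \<Gamma> bipartition_swap[OF bip] Y] x'_def)
    qed
    moreover have "\<exists>u\<in>sverts \<Gamma>. x' u \<noteq> 0" using x(1) by (auto simp: x'_def)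
    moreover have "sg_spectral_radius \<Gamma> = - k" using k False by simp
    ultimately show ?thesis by (intro that[of x']) simp_all
  qed
qed

section \<open>Balance, 4-cycles and the choice of the switching\<close>

text \<open>The product telescopes, since each inner visit contributes a square. On a closed walk
  \<open>s u * s u = 1\<close> remains, which a negative cycle contradicts.\<close>

lemma walk_sign_product:
  assumes "pcas u p v" "\<And>e. e \<in> set p \<Longrightarrow> esign \<Gamma> (fst e) (snd e) \<in> {-1, 1}"
    and "\<And>e. e \<in> set p \<Longrightarrow> real_of_int (esign \<Gamma> (fst e) (snd e)) = s (fst e) * s (snd e)"
    and "s u \<in> {-1, 1 :: real}"
  shows "(-1) ^ length (filter (\<lambda>(u, v). esign \<Gamma> u v = -1) p) = s u * s v"
  using assms
proof (induction p arbitrary: u)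
  case Nil
  then show ?case by auto
next
  case (Cons e p)
  obtain b where e: "e = (u, b)" using Cons.prems(1) by (cases e) auto
  have sg: "esign \<Gamma> u b \<in> {-1, 1}" "real_of_int (esign \<Gamma> u b) = s u * s b"
    using Cons.prems(2,3)[of e] e by auto
  have sb: "s b \<in> {-1, 1}" using sg Cons.prems(4) by auto
  have IH: "(-1) ^ length (filter (\<lambda>(u, v). esign \<Gamma> u v = -1) p) = s b * s v"
    by (rule Cons.IH) (use Cons.prems sb e in auto)
  show ?case using IH sg sb Cons.prems(4) by (auto simp: e)
qed

lemma unbalanced_no_switching:
  assumes \<Gamma>: "signed_graph \<Gamma>" and bip: "bipartition \<Gamma> X Y" and unb: "unbalanced \<Gamma>"
  shows "\<not> (\<exists>s. (\<forall>u\<in>X \<union> Y. s u \<in> {-1, 1}) \<and> (\<forall>x\<in>X. \<forall>y\<in>Y. s x * s y * sg_weight \<Gamma> x y \<ge> 0))"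
proof
  assume "\<exists>s. (\<forall>u\<in>X \<union> Y. s u \<in> {-1, 1}) \<and> (\<forall>x\<in>X. \<forall>y\<in>Y. s x * s y * sg_weight \<Gamma> x y \<ge> 0)"
  then obtain s where s: "\<And>u. u \<in> X \<union> Y \<Longrightarrow> s u \<in> {-1, 1}"
    "\<And>x y. x \<in> X \<Longrightarrow> y \<in> Y \<Longrightarrow> s x * s y * sg_weight \<Gamma> x y \<ge> 0" by blast
  obtain p where p: "pre_digraph.cycle (with_proj (fst \<Gamma>)) p"
    and odd: "odd (length (filter (\<lambda>(u, v). esign \<Gamma> u v = -1) p))"
    using unb by (auto simp: unbalanced_def negative_cycle_def)
  obtain u where u: "u \<in> sverts \<Gamma>" "set p \<subseteq> sarcs \<Gamma>" "pcas u p u"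
    using p by (auto simp: pre_digraph.cycle_def pre_digraph.awalk_def cas_with_proj_eq)
  have prod: "real_of_int (esign \<Gamma> a b) = s a * s b" if "(a, b) \<in> sarcs \<Gamma>" for a b
  proof -
    note ab = signed_graphD(2)[OF \<Gamma> that]
    have "s a * s b * sg_weight \<Gamma> a b \<ge> 0"
    proof (cases "a \<in> X \<and> b \<in> Y")
      case True
      then show ?thesis using s(2) by blast
    next
      case False
      then have "a \<in> Y" "b \<in> X" using bip that by (auto simp: bipartition_def)
      then have "s b * s a * sg_weight \<Gamma> b a \<ge> 0" using s(2) by blast
      then show ?thesis by (simp add: sg_weight_sym[OF \<Gamma>, of a b] mult.commute)
    qed
    moreover have "s a \<in> {-1, 1}" "s b \<in> {-1, 1}"
      using s(1) ab bip by (auto simp: bipartition_def)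
    ultimately show ?thesis using that ab by (auto simp: sg_weight_def)
  qed
  have su: "s u \<in> {-1, 1}" using s(1) u(1) bip by (auto simp: bipartition_def)
  have "esign \<Gamma> (fst e) (snd e) \<in> {-1, 1}" "real_of_int (esign \<Gamma> (fst e) (snd e)) = s (fst e) * s (snd e)"
    if "e \<in> set p" for e
    using that u(2) prod[of "fst e" "snd e"] signed_graphD(2)[OF \<Gamma>, of "fst e" "snd e"] by auto
  then have "(-1) ^ length (filter (\<lambda>(u, v). esign \<Gamma> u v = -1) p) = s u * s u"
    using walk_sign_product[OF u(3), of \<Gamma> s] su by blast
  moreover have "s u * s u = 1" using su by auto
  ultimately show False using odd by simp
qed

lemma four_cycle_weights:
  assumes \<Gamma>: "signed_graph \<Gamma>" and bip: "bipartition \<Gamma> X Y"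
    and no4: "\<not> (\<exists>p. negative_cycle \<Gamma> p \<and> length p = 4)"
    and xy: "x \<in> X" "x' \<in> X" "y \<in> Y" "y' \<in> Y" "x \<noteq> x'" "y \<noteq> y'"
  shows "sg_weight \<Gamma> x y * sg_weight \<Gamma> x y' * sg_weight \<Gamma> x' y * sg_weight \<Gamma> x' y' \<ge> 0"
proof (cases "(x, y) \<in> sarcs \<Gamma> \<and> (x, y') \<in> sarcs \<Gamma> \<and> (x', y) \<in> sarcs \<Gamma> \<and> (x', y') \<in> sarcs \<Gamma>")
  case True
  let ?p = "[(x, y), (y, x'), (x', y'), (y', x)]"
  note arcs = signed_graphD(2)[OF \<Gamma>, of x y] signed_graphD(2)[OF \<Gamma>, of x y']
    signed_graphD(2)[OF \<Gamma>, of x' y] signed_graphD(2)[OF \<Gamma>, of x' y']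
  have "x \<noteq> y" "x \<noteq> y'" "x' \<noteq> y" "x' \<noteq> y'" using xy bip by (auto simp: bipartition_def)
  then have "pre_digraph.cycle (with_proj (fst \<Gamma>)) ?p"
    unfolding pre_digraph.cycle_def pre_digraph.awalk_def cas_with_proj_eq awalk_verts_with_proj_eq
    using True arcs xy by (intro exI[of _ x]) auto
  then have "even (length (filter (\<lambda>(u, v). esign \<Gamma> u v = -1) ?p))"
    using no4 by (fastforce simp: negative_cycle_def)
  moreover have "esign \<Gamma> y x' = esign \<Gamma> x' y" "esign \<Gamma> y' x = esign \<Gamma> x y'" by (simp_all add: insert_commute)
  ultimately show ?thesis using True arcs
    by (auto simp: sg_weight_def split: if_splits)
qed (auto simp: sg_weight_def)

text \<open>The signs \<open>s\<close> are forced where \<open>x\<close> is nonzero and free at its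
  zeros; minimising the number of negative arcs uses up this freedom. Suppose a vertex on a negative
  edge had no positive one. If \<open>x\<close> is nonzero there, the eigenvector equation fails
  because the spectral radius is positive; if \<open>x\<close> is zero there, switching at that
  vertex alone stays admissible and lowers the count.\<close>

lemma nonneg_switching:
  assumes \<Gamma>: "signed_graph \<Gamma>" and bip: "bipartition \<Gamma> X Y"
    and no4: "\<not> (\<exists>p. negative_cycle \<Gamma> p \<and> length p = 4)" and unb: "unbalanced \<Gamma>"
    and pos: "sg_spectral_radius \<Gamma> > 0" and ne: "sverts \<Gamma> \<noteq> {}"
  obtains s z where "\<And>u. s u \<in> {-1, 1}"
    and "nonneg_eigenvector X Y (\<lambda>u v. s u * s v * sg_weight \<Gamma> u v) z (sg_spectral_radius \<Gamma>)"
proof -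
  let ?V = "sverts \<Gamma>" and ?\<rho> = "sg_spectral_radius \<Gamma>"
  let ?w = "\<lambda>s u v. s u * s v * sg_weight \<Gamma> u v"
  obtain x where x: "\<exists>u\<in>?V. x u \<noteq> 0"
    "\<And>u. u \<in> ?V \<Longrightarrow> (\<Sum>v\<in>?V. sg_weight \<Gamma> u v * x v) = ?\<rho> * x u"
    by (rule bipartite_eigenvector[OF \<Gamma> ne bip]) blast
  have fin: "finite ?V" using signed_graphD(1)[OF \<Gamma>] .
  have V: "X \<union> Y = ?V" "X \<inter> Y = {}" using bip by (auto simp: bipartition_def)
  define adm where "adm s \<longleftrightarrow> (\<forall>u. s u \<in> {-1, 1}) \<and> (\<forall>u. s u * x u = \<bar>x u\<bar>)" for s :: "'a \<Rightarrow> real"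
  define negs where "negs s = {(u, v). u \<in> ?V \<and> v \<in> ?V \<and> ?w s u v = -1}" for s
  have "adm (\<lambda>u. if x u < 0 then -1 else 1)" by (auto simp: adm_def)
  then obtain s where s: "adm s" and min: "\<And>s'. adm s' \<Longrightarrow> card (negs s) \<le> card (negs s')"
    using ex_has_least_nat[of adm _ "\<lambda>s. card (negs s)"] by blast
  have sv: "s u \<in> {-1, 1}" and sx: "s u * x u = \<bar>x u\<bar>" for u using s by (auto simp: adm_def)
  have ss: "s u * s u = 1" for u using sv[of u] by auto
  have fin_negs: "finite (negs s)"
    by (rule finite_subset[of _ "?V \<times> ?V"]) (use fin in \<open>auto simp: negs_def\<close>)
  have eig: "(\<Sum>v\<in>?V. ?w s u v * \<bar>x v\<bar>) = ?\<rho> * \<bar>x u\<bar>" if "u \<in> ?V" for u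
  proof -
    have "(\<Sum>v\<in>?V. ?w s u v * \<bar>x v\<bar>) = (\<Sum>v\<in>?V. s u * (sg_weight \<Gamma> u v * x v))"
    proof (rule sum.cong)
      fix v assume "v \<in> ?V"
      have "?w s u v * \<bar>x v\<bar> = (s v * s v) * (s u * (sg_weight \<Gamma> u v * x v))"
        unfolding sx[symmetric] by (simp only: mult_ac)
      then show "?w s u v * \<bar>x v\<bar> = s u * (sg_weight \<Gamma> u v * x v)" by (simp only: ss mult_1)
    qed simp
    also have "\<dots> = s u * (?\<rho> * x u)" unfolding sum_distrib_left[symmetric] by (simp only: x(2)[OF that])
    also have "\<dots> = ?\<rho> * \<bar>x u\<bar>" unfolding sx[symmetric] by (simp only: mult_ac)
    finally show ?thesis .
  qed
  have wval: "?w s u v \<in> {-1, 0, 1}" for u v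
    using sv[of u] sv[of v] sg_weight_values[OF \<Gamma>, of u v] by auto
  have good: "\<exists>l'\<in>?V. ?w s k l' = 1" if k: "k \<in> ?V" and l: "l \<in> ?V" and kl: "?w s k l = -1" for k l
  proof (rule ccontr)
    assume "\<not> ?thesis"
    then have none: "?w s k v \<le> 0" if "v \<in> ?V" for v
      using that wval[of k v] by auto
    show False
    proof (cases "x k = 0")
      case False
      have "(\<Sum>v\<in>?V. ?w s k v * \<bar>x v\<bar>) \<le> 0"
        by (intro sum_nonpos mult_nonpos_nonneg none) auto
      moreover have "?\<rho> * \<bar>x k\<bar> > 0" using False pos by simp
      ultimately show False using eig[OF k] by linarith
    next
      case True
      define s' where "s' = s(k := - s k)"
      have adm': "adm s'" using sv sx True by (auto simp: adm_def s'_def)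
      have loop: "sg_weight \<Gamma> k k = 0" using signed_graphD(2)[OF \<Gamma>, of k k] by (auto simp: sg_weight_def)
      have sub: "negs s' \<subseteq> negs s"
      proof
        fix e assume "e \<in> negs s'"
        then obtain u v where e: "e = (u, v)" "u \<in> ?V" "v \<in> ?V" "?w s' u v = -1"
          by (auto simp: negs_def)
        have "?w s k u = ?w s u k" by (simp add: sg_weight_sym[OF \<Gamma>, of k u] mult_ac)
        then have "?w s u k \<le> 0" using none[OF e(2)] by linarith
        then have "u \<noteq> k \<and> v \<noteq> k"
          using e none[of v] loop by (auto simp: s'_def split: if_splits)
        then show "e \<in> negs s" using e by (simp add: negs_def s'_def)
      qed
      have "(k, l) \<in> negs s" using k l kl by (simp add: negs_def)
      moreover have "(k, l) \<notin> negs s'" 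
        using kl loop by (cases "l = k") (auto simp: negs_def s'_def)
      ultimately have "card (negs s') < card (negs s)"
        using sub fin_negs by (intro psubset_card_mono) auto
      then show False using min[OF adm'] by simp
    qed
  qed
  have sum_X: "(\<Sum>v\<in>Y. ?w s u v * \<bar>x v\<bar>) = ?\<rho> * \<bar>x u\<bar>" if "u \<in> X" for u
  proof -
    have "u \<in> ?V" using that V by blast
    from eig[OF this] show ?thesis
      using bipartite_sum[OF \<Gamma> bip that, of "\<lambda>v. s u * s v * \<bar>x v\<bar>"] by (simp add: mult_ac)
  qed
  have sum_Y: "(\<Sum>v\<in>X. ?w s u v * \<bar>x v\<bar>) = ?\<rho> * \<bar>x u\<bar>" if "u \<in> Y" for u
  proof -
    have "u \<in> ?V" using that V by blast
    from eig[OF this] show ?thesis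
      using bipartite_sum[OF \<Gamma> bipartition_swap[OF bip] that, of "\<lambda>v. s u * s v * \<bar>x v\<bar>"] by (simp add: mult_ac)
  qed
  have w_bip: "u \<in> X \<and> v \<in> Y \<or> u \<in> Y \<and> v \<in> X" if "?w s u v \<noteq> 0" for u v
    using bipartition_weight[OF bip] that by auto
  have "nonneg_eigenvector X Y (?w s) (\<lambda>u. \<bar>x u\<bar>) ?\<rho>"
  proof
    show "finite X" "finite Y" using V(1) fin by (metis finite_Un)+
    show "X \<inter> Y = {}" by (fact V(2))
    show "?w s u v = ?w s v u" for u v by (simp add: sg_weight_sym[OF \<Gamma>, of v u] mult_ac)
    show "?w s u v \<in> {-1, 0, 1}" for u v by (fact wval)
    show "?w s a b * ?w s a b' * ?w s a' b * ?w s a' b' \<ge> 0"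
      if "a \<in> X" "a' \<in> X" "b \<in> Y" "b' \<in> Y" "a \<noteq> a'" "b \<noteq> b'" for a a' b b'
    proof -
      have "?w s a b * ?w s a b' * ?w s a' b * ?w s a' b' = (s a * s a) * (s a' * s a') * (s b * s b) * (s b' * s b') * 
         (sg_weight \<Gamma> a b * sg_weight \<Gamma> a b' * sg_weight \<Gamma> a' b * sg_weight \<Gamma> a' b')" by (simp only: mult_ac)
      also have "\<dots> = sg_weight \<Gamma> a b * sg_weight \<Gamma> a b' * sg_weight \<Gamma> a' b * sg_weight \<Gamma> a' b'"
        by (simp only: ss mult_1)
      finally show ?thesis using four_cycle_weights[OF \<Gamma> bip no4 that] by (simp only:)
    qed
    show "\<exists>u\<in>X \<union> Y. \<bar>x u\<bar> \<noteq> 0" using x(1) V(1) by simp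
    show "\<exists>y\<in>Y. ?w s a y = 1" if ab: "a \<in> X" "b \<in> Y" "?w s a b = -1" for a b
    proof -
      have "a \<in> ?V" "b \<in> ?V" using ab(1,2) V(1) by blast+
      then obtain l where "?w s a l = 1" using good[OF _ _ ab(3)] by blast
      moreover from this have "l \<in> Y" using w_bip[of a l] ab(1) V(2) by auto
      ultimately show ?thesis by blast
    qed
    show "\<exists>a\<in>X. ?w s a b = 1" if "a \<in> X" "b \<in> Y" "?w s a b = -1" for a b
    proof -
      have sym: "?w s u v = ?w s v u" for u v by (simp add: sg_weight_sym[OF \<Gamma>, of v u] mult_ac)
      have "a \<in> ?V" "b \<in> ?V" using that(1,2) V(1) by blast+
      moreover have "?w s b a = -1" using that(3) sym[of a b] by linarith
      ultimately obtain l where l: "?w s b l = 1" using good[of b a] by blast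
      then have "l \<in> X" using w_bip[of b l] that(2) V(2) by auto
      moreover have "?w s l b = 1" using l sym[of b l] by linarith
      ultimately show ?thesis by blast
    qed
    show "\<not> (\<exists>s'. (\<forall>u\<in>X \<union> Y. s' u \<in> {-1, 1}) \<and> (\<forall>a\<in>X. \<forall>b\<in>Y. s' a * s' b * ?w s a b \<ge> 0))"
    proof
      assume "\<exists>s'. (\<forall>u\<in>X \<union> Y. s' u \<in> {-1, 1}) \<and> (\<forall>a\<in>X. \<forall>b\<in>Y. s' a * s' b * ?w s a b \<ge> 0)"
      then obtain s' where s': "\<forall>u\<in>X \<union> Y. s' u \<in> {-1, 1}" "\<forall>a\<in>X. \<forall>b\<in>Y. s' a * s' b * ?w s a b \<ge> 0" by blast
      have "\<forall>a\<in>X. \<forall>b\<in>Y. (s' a * s a) * (s' b * s b) * sg_weight \<Gamma> a b \<ge> 0"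
        using s'(2) by (simp add: mult_ac)
      moreover have "\<forall>u\<in>X \<union> Y. s' u * s u \<in> {-1, 1}"
      proof
        fix u assume "u \<in> X \<union> Y"
        then have "s' u \<in> {-1, 1}" using s'(1) by blast
        then show "s' u * s u \<in> {-1, 1}" using sv[of u] by auto
      qed
      ultimately show False using unbalanced_no_switching[OF \<Gamma> bip unb]
        by (auto dest!: spec[of _ "\<lambda>u. s' u * s u"])
    qed
  qed (use sum_X sum_Y pos in auto)
  then show ?thesis using that sv by blast
qed

section \<open>The extremal graph\<close>

text \<open>The weights between the parts of \<open>Gamma_rs\<close> with its four special vertices
  as parameters. It is the hexagon with \<open>P = {u}\<close> and \<open>Q = {v}\<close>.\<close>

definition gamma_weight :: "'a \<Rightarrow> 'b \<Rightarrow> 'a \<Rightarrow> 'b \<Rightarrow> 'a \<Rightarrow> 'b \<Rightarrow> real" where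
  "gamma_weight u v u1 v1 x y =
    (if x = u1 then if y = v1 then -1 else if y = v then 1 else 0
     else if y = v1 then if x = u then 1 else 0
     else if x = u \<and> y = v then 0 else 1)"

lemma sverts_Gamma_rs:
  "r \<ge> 2 \<Longrightarrow> s \<ge> 2 \<Longrightarrow> sverts (Gamma_rs r s) = Inl ` {..<r} \<union> Inr ` {..<s}"
  by (auto simp: Gamma_rs_def Let_def image_iff)

lemma sign_Gamma_rs: "snd (Gamma_rs r s) e = (if e = {Inr (s - 1), Inl (r - 1)} then -1 else 1)"
  by (simp add: Gamma_rs_def Let_def)

lemma sarcs_Gamma_rs:
  shows "(Inl i, Inr j) \<in> sarcs (Gamma_rs r s) \<longleftrightarrow> i < r - 1 \<and> j < s - 1 \<and> (i, j) \<noteq> (0, 0) \<or>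
      (i, j) \<in> {(0, s - 1), (r - 1, s - 1), (r - 1, 0)}"
    and "(Inr j, Inl i) \<in> sarcs (Gamma_rs r s) \<longleftrightarrow> (Inl i, Inr j) \<in> sarcs (Gamma_rs r s)"
    and "(Inl i, Inl i') \<notin> sarcs (Gamma_rs r s)"
    and "(Inr j, Inr j') \<notin> sarcs (Gamma_rs r s)"
  by (auto simp: Gamma_rs_def Let_def)

lemma sg_weight_Gamma_rs:
  assumes "r \<ge> 2" "s \<ge> 2"
  shows "i < r \<Longrightarrow> j < s \<Longrightarrow> sg_weight (Gamma_rs r s) (Inl i) (Inr j) = gamma_weight 0 0 (r - 1) (s - 1) i j"
    and "i < r \<Longrightarrow> j < s \<Longrightarrow> sg_weight (Gamma_rs r s) (Inr j) (Inl i) = gamma_weight 0 0 (r - 1) (s - 1) i j"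
    and "sg_weight (Gamma_rs r s) (Inl i) (Inl i') = 0"
    and "sg_weight (Gamma_rs r s) (Inr j) (Inr j') = 0"
proof -
  assume ij: "i < r" "j < s"
  have i: "i < r - 1 \<longleftrightarrow> i \<noteq> r - 1" and j: "j < s - 1 \<longleftrightarrow> j \<noteq> s - 1" using ij by auto
  have ends: "r - 1 \<noteq> 0" "s - 1 \<noteq> 0" using assms by simp_all
  show "sg_weight (Gamma_rs r s) (Inl i) (Inr j) = gamma_weight 0 0 (r - 1) (s - 1) i j"
    unfolding sg_weight_def sarcs_Gamma_rs sign_Gamma_rs gamma_weight_def i j doubleton_eq_iff
    using ends by auto
  show "sg_weight (Gamma_rs r s) (Inr j) (Inl i) = gamma_weight 0 0 (r - 1) (s - 1) i j"
    unfolding sg_weight_def sarcs_Gamma_rs sign_Gamma_rs gamma_weight_def i j doubleton_eq_iff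
    using ends by auto
qed (simp_all add: sg_weight_def sarcs_Gamma_rs)

lemma arc_Gamma_rs:
  "(a, b) \<in> sarcs (Gamma_rs r s) \<longleftrightarrow> sg_weight (Gamma_rs r s) a b \<noteq> 0"
  by (simp add: sg_weight_def sign_Gamma_rs)

lemma esign_switch:
  assumes "u \<noteq> v"
  shows "esign (switch U \<Gamma>) u v = (if u \<in> U \<longleftrightarrow> v \<in> U then esign \<Gamma> u v else - esign \<Gamma> u v)"
proof -
  have "{u, v} \<inter> U = (if u \<in> U then {u} else {}) \<union> (if v \<in> U then {v} else {})" by auto
  then show ?thesis using assms by (simp add: switch_def)
qed

lemma bij_betw_lessThan_ends:
  assumes "finite X" "card X = r" "u \<in> X" "u1 \<in> X" "u \<noteq> u1"
  obtains f where "bij_betw f X {..<r}" "f u = 0" "f u1 = r - 1"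
proof -
  have card: "card (X - {u, u1}) = r - 2"
    using assms by (simp add: card_Diff_subset)
  have "card {u, u1} \<le> card X" using assms by (intro card_mono) auto
  then have r: "r \<ge> 2" using assms by simp
  have "card (X - {u, u1}) = card {1..<r - 1}" using card r by simp
  then obtain g where g: "bij_betw g (X - {u, u1}) {1..<r - 1}"
    using finite_same_card_bij assms(1) by (metis finite_Diff finite_atLeastLessThan)
  define f where "f x = (if x = u then 0 else if x = u1 then r - 1 else g x)" for x
  have 1: "bij_betw f (X - {u, u1}) {1..<r - 1}"
    using g by (rule bij_betw_cong[THEN iffD2, rotated]) (simp add: f_def)
  have 2: "bij_betw f {u, u1} {0, r - 1}"
    using assms(5) r by (auto simp: bij_betw_def f_def)
  have "bij_betw f ((X - {u, u1}) \<union> {u, u1}) ({1..<r - 1} \<union> {0, r - 1})"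
    by (rule bij_betw_combine[OF 1 2]) auto
  moreover have "(X - {u, u1}) \<union> {u, u1} = X" using assms by auto
  moreover have "{1..<r - 1} \<union> {0, r - 1} = {..<r}" using r by auto
  ultimately have "bij_betw f X {..<r}" by simp
  then show ?thesis using that assms(5) by (simp add: f_def)
qed

text \<open>Recognises the extremal graph from its weights between the parts, up to signs
  \<open>\<epsilon>\<close>. Relabelling the parts gives the isomorphism, and the image of the
  vertices with \<open>\<epsilon> x = -1\<close> is the set in which \<open>Gamma_rs\<close> is
  switched.\<close>

lemma switching_isomorphic_Gamma_rs:
  assumes \<Gamma>: "signed_graph \<Gamma>" and bip: "bipartition \<Gamma> X Y"
    and card: "card X = r" "card Y = s"
    and u: "u \<in> X" "u1 \<in> X" "u \<noteq> u1" and v: "v \<in> Y" "v1 \<in> Y" "v \<noteq> v1"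
    and \<epsilon>: "\<And>x. \<epsilon> x \<in> {-1, 1 :: real}"
    and weight: "\<And>x y. x \<in> X \<Longrightarrow> y \<in> Y \<Longrightarrow> \<epsilon> x * \<epsilon> y * sg_weight \<Gamma> x y = gamma_weight u v u1 v1 x y"
  shows "switching_isomorphic \<Gamma> (Gamma_rs r s)"
proof -
  have V: "X \<union> Y = sverts \<Gamma>" "X \<inter> Y = {}" using bip by (auto simp: bipartition_def)
  then have fin: "finite X" "finite Y" using signed_graphD(1)[OF \<Gamma>] by (metis finite_Un)+
  have rs: "r \<ge> 2" "s \<ge> 2"
    using card_mono[of X "{u, u1}"] card_mono[of Y "{v, v1}"] u v fin card by auto
  obtain f where f: "bij_betw f X {..<r}" "f u = 0" "f u1 = r - 1"
    by (rule bij_betw_lessThan_ends[OF fin(1) card(1) u]) blast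
  obtain h where h: "bij_betw h Y {..<s}" "h v = 0" "h v1 = s - 1"
    by (rule bij_betw_lessThan_ends[OF fin(2) card(2) v]) blast
  let ?G = "Gamma_rs r s"
  define F where "F x = (if x \<in> X then Inl (f x) else Inr (h x))" for x
  have FX: "x \<in> X \<Longrightarrow> F x = Inl (f x)" and FY: "x \<in> Y \<Longrightarrow> F x = Inr (h x)" for x
    using V by (auto simp: F_def)
  have "bij_betw F X (Inl ` {..<r})"
    using f(1) by (auto simp: bij_betw_def inj_on_def FX image_image[symmetric] image_iff) 
  moreover have "bij_betw F Y (Inr ` {..<s})"
    using h(1) by (auto simp: bij_betw_def inj_on_def FY image_image[symmetric] image_iff)
  ultimately have "bij_betw F (X \<union> Y) (Inl ` {..<r} \<union> Inr ` {..<s})"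
    by (rule bij_betw_combine) auto
  then have F: "bij_betw F (sverts \<Gamma>) (sverts ?G)"
    by (simp add: V(1) sverts_Gamma_rs[OF rs])
  have Finj: "F x = F y \<longleftrightarrow> x = y" if "x \<in> sverts \<Gamma>" "y \<in> sverts \<Gamma>" for x y
    using F that by (auto simp: bij_betw_def inj_on_def)
  have fu: "f x = 0 \<longleftrightarrow> x = u" "f x = r - 1 \<longleftrightarrow> x = u1" "f x < r" if "x \<in> X" for x
  proof -
    have "f x = f y \<longleftrightarrow> x = y" if "y \<in> X" for y
      using inj_on_eq_iff[OF bij_betw_imp_inj_on[OF f(1)]] \<open>x \<in> X\<close> that by blast
    from this[OF u(1)] this[OF u(2)] show "f x = 0 \<longleftrightarrow> x = u" "f x = r - 1 \<longleftrightarrow> x = u1"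
      by (simp_all add: f(2,3))
    show "f x < r" using bij_betwE[OF f(1)] that by simp
  qed
  have hv: "h x = 0 \<longleftrightarrow> x = v" "h x = s - 1 \<longleftrightarrow> x = v1" "h x < s" if "x \<in> Y" for x
  proof -
    have "h x = h y \<longleftrightarrow> x = y" if "y \<in> Y" for y
      using inj_on_eq_iff[OF bij_betw_imp_inj_on[OF h(1)]] \<open>x \<in> Y\<close> that by blast
    from this[OF v(1)] this[OF v(2)] show "h x = 0 \<longleftrightarrow> x = v" "h x = s - 1 \<longleftrightarrow> x = v1"
      by (simp_all add: h(2,3))
    show "h x < s" using bij_betwE[OF h(1)] that by simp
  qed
  have GXY: "sg_weight ?G (F x) (F y) = \<epsilon> x * \<epsilon> y * sg_weight \<Gamma> x y" if "x \<in> X" "y \<in> Y" for x y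
    unfolding weight[OF that] FX[OF that(1)] FY[OF that(2)] sg_weight_Gamma_rs(1)[OF rs fu(3)[OF that(1)] hv(3)[OF that(2)]]
    by (simp only: gamma_weight_def fu[OF that(1)] hv[OF that(2)])
  have GYX: "sg_weight ?G (F y) (F x) = \<epsilon> x * \<epsilon> y * sg_weight \<Gamma> x y" if "x \<in> X" "y \<in> Y" for x y
    unfolding weight[OF that] FX[OF that(1)] FY[OF that(2)] sg_weight_Gamma_rs(2)[OF rs fu(3)[OF that(1)] hv(3)[OF that(2)]]
    by (simp only: gamma_weight_def fu[OF that(1)] hv[OF that(2)])
  have G: "sg_weight ?G (F x) (F y) = \<epsilon> x * \<epsilon> y * sg_weight \<Gamma> x y"
    if "x \<in> sverts \<Gamma>" "y \<in> sverts \<Gamma>" for x y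
  proof -
    have "x \<in> X \<or> x \<in> Y" "y \<in> X \<or> y \<in> Y" using that by (simp_all flip: V(1))
    then consider "x \<in> X" "y \<in> Y" | "x \<in> Y" "y \<in> X" | "x \<in> X" "y \<in> X" | "x \<in> Y" "y \<in> Y"
      by blast
    then show ?thesis
    proof cases
      case 1
      then show ?thesis by (rule GXY)
    next
      case 2
      then show ?thesis using GYX[of y x] by (simp add: sg_weight_sym[OF \<Gamma>, of x y] mult_ac)
    next
      case 3
      then have "sg_weight \<Gamma> x y = 0" using bipartition_weight[OF bip, of x y] V(2) by auto
      then show ?thesis by (simp add: FX[OF 3(1)] FX[OF 3(2)] sg_weight_Gamma_rs[OF rs])
    next
      case 4
      then have "sg_weight \<Gamma> x y = 0" using bipartition_weight[OF bip, of x y] V(2) by auto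
      then show ?thesis by (simp add: FY[OF 4(1)] FY[OF 4(2)] sg_weight_Gamma_rs[OF rs])
    qed
  qed
  define U where "U = F ` {x \<in> sverts \<Gamma>. \<epsilon> x = -1}"
  have U: "F x \<in> U \<longleftrightarrow> \<epsilon> x = -1" if "x \<in> sverts \<Gamma>" for x
    unfolding U_def using Finj that by auto
  have arcs: "(x, y) \<in> sarcs \<Gamma> \<longleftrightarrow> (F x, F y) \<in> sarcs ?G" if "x \<in> sverts \<Gamma>" "y \<in> sverts \<Gamma>" for x y
  proof -
    have "(x, y) \<in> sarcs \<Gamma> \<longleftrightarrow> sg_weight \<Gamma> x y \<noteq> 0"
      using signed_graphD(2)[OF \<Gamma>, of x y] by (auto simp: sg_weight_def)
    then show ?thesis using G[OF that] \<epsilon>[of x] \<epsilon>[of y] by (auto simp: arc_Gamma_rs)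
  qed
  have sign: "esign (switch U ?G) (F x) (F y) = esign \<Gamma> x y" if xy: "(x, y) \<in> sarcs \<Gamma>" for x y
  proof -
    note d = signed_graphD(2)[OF \<Gamma> xy]
    have "F x \<noteq> F y" using d Finj by auto
    moreover have "real_of_int (esign ?G (F x) (F y)) = \<epsilon> x * \<epsilon> y * real_of_int (esign \<Gamma> x y)"
      using G[of x y] arcs[of x y] d xy by (simp add: sg_weight_def)
    ultimately have "real_of_int (esign (switch U ?G) (F x) (F y)) = real_of_int (esign \<Gamma> x y)"
      unfolding esign_switch[OF \<open>F x \<noteq> F y\<close>] using U[of x] U[of y] d \<epsilon>[of x] \<epsilon>[of y] by auto
    then show ?thesis by (simp only: of_int_eq_iff)
  qed
  have "switching_equivalent ?G (switch U ?G)"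
    unfolding switching_equivalent_def
    using F by (intro exI[of _ U]) (auto simp: U_def switch_def bij_betw_def)
  moreover have fst_switch: "fst (switch U ?G) = fst ?G" by (simp add: switch_def)
  have "sg_isomorphic \<Gamma> (switch U ?G)"
    unfolding sg_isomorphic_def
    using F arcs sign by (intro exI[of _ F]) (auto simp: fst_switch)
  ultimately show ?thesis unfolding switching_isomorphic_def by blast
qed

section \<open>Eigenvectors of the extremal graph and their transport\<close>

lemma singular_2x2_kernel:
  fixes a b c d :: real
  assumes "a * d = b * c"
  obtains x y where "x \<noteq> 0 \<or> y \<noteq> 0" "a * x + b * y = 0" "c * x + d * y = 0"
proof (cases "a = 0 \<and> b = 0")
  case True
  show ?thesis
  proof (cases "c = 0 \<and> d = 0")
    case True
    then show ?thesis using that[of 1 0] \<open>a = 0 \<and> b = 0\<close> by simp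
  next
    case False
    then have "d \<noteq> 0 \<or> - c \<noteq> 0" by auto
    then show ?thesis by (rule that) (use True in simp_all)
  qed
next
  case False
  then have "b \<noteq> 0 \<or> - a \<noteq> 0" by auto
  then show ?thesis by (rule that) (use assms in \<open>simp_all add: algebra_simps\<close>)
qed

lemma sum_lessThan_ends:
  fixes \<phi> :: "nat \<Rightarrow> real"
  assumes "r \<ge> 2" "\<And>i. 0 < i \<Longrightarrow> i < r - 1 \<Longrightarrow> \<phi> i = k"
  shows "(\<Sum>i<r. \<phi> i) = \<phi> 0 + \<phi> (r - 1) + (real r - 2) * k"
proof -
  have "{..<r} = insert 0 (insert (r - 1) {1..<r - 1})" using assms(1) by auto
  moreover have "(\<Sum>i\<in>{1..<r - 1}. \<phi> i) = (\<Sum>i\<in>{1..<r - 1}. k)"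
    using assms(2) by (intro sum.cong) auto
  ultimately show ?thesis using assms(1) by (simp add: of_nat_diff)
qed

text \<open>The vector takes the values \<open>\<alpha>\<close>, \<open>\<beta>\<close>,
  \<open>\<gamma>\<close> on \<open>u1\<close>, \<open>u\<close> and the other vertices of the first
  part, and the primed values on \<open>v1\<close>, \<open>v\<close> and the others of the second.
  Eliminating the primed values and \<open>\<gamma>\<close> leaves a 2x2 system in
  \<open>\<alpha>\<close> and \<open>\<beta>\<close> that is singular exactly when the quadratic
  vanishes at \<open>\<tau>\<^sup>2\<close>.\<close>

lemma Gamma_rs_eigenvector:
  assumes rs: "r \<ge> 3" "s \<ge> 3" and \<tau>: "\<tau> > 0"
    and root: "(\<tau>\<^sup>2)\<^sup>2 - (real (r - 1) * real (s - 1) + 2) * \<tau>\<^sup>2 + (2 * real (r - 1) - 1) * (2 * real (s - 1) - 1) = 0"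
  obtains e where "\<exists>a\<in>sverts (Gamma_rs r s). e a \<noteq> 0"
    and "\<And>a. a \<in> sverts (Gamma_rs r s) \<Longrightarrow>
      (\<Sum>b\<in>sverts (Gamma_rs r s). sg_weight (Gamma_rs r s) a b * e b) = \<tau> * e a"
proof -
  let ?G = "Gamma_rs r s"
  have rs2: "r \<ge> 2" "s \<ge> 2" using rs by simp_all
  \<comment> \<open>\<open>A\<close> and \<open>C\<close> count the generic vertices of the two
    parts.\<close>
  define A C t where ACt: "A = real r - 2" "C = real s - 2" "t = \<tau>\<^sup>2"
  have root': "t\<^sup>2 - ((A + 1) * (C + 1) + 2) * t + (2 * A + 1) * (2 * C + 1) = 0"
    using root rs unfolding ACt by (simp add: of_nat_diff algebra_simps)
  obtain \<alpha> \<beta> where nz: "\<alpha> \<noteq> 0 \<or> \<beta> \<noteq> 0"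
    and eq: "(2 + A - t) * \<alpha> + (A - 1) * \<beta> = 0" "(C * A - 1) * \<alpha> + (1 + C + C * A - t) * \<beta> = 0"
  proof (rule singular_2x2_kernel)
    show "(2 + A - t) * (1 + C + C * A - t) = (A - 1) * (C * A - 1)"
      using root' by (simp add: power2_eq_square algebra_simps)
  qed blast
  \<comment> \<open>The row of a generic vertex is the sum of the rows of \<open>u1\<close> and \<open>u\<close>, hence \<open>\<gamma> = \<alpha> + \<beta>\<close>.\<close>
  define \<gamma> \<alpha>' \<beta>' \<gamma>' where g: "\<gamma> = \<alpha> + \<beta>" and
    ys: "\<alpha>' = (\<beta> - \<alpha>) / \<tau>" "\<beta>' = (\<alpha> + A * \<gamma>) / \<tau>" "\<gamma>' = (\<beta> + A * \<gamma>) / \<tau>"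
  have y: "\<tau> * \<alpha>' = - \<alpha> + \<beta>" "\<tau> * \<beta>' = \<alpha> + A * \<gamma>" "\<tau> * \<gamma>' = \<beta> + A * \<gamma>"
    unfolding ys using \<tau> by simp_all
  have cancel: "p = q" if "\<tau> * p = \<tau> * q" for p q using that \<tau> by simp
  have x: "\<tau> * \<alpha> = - \<alpha>' + \<beta>'" "\<tau> * \<beta> = \<alpha>' + C * \<gamma>'" "\<tau> * \<gamma> = \<beta>' + C * \<gamma>'"
  proof -
    have "\<tau> * (- \<alpha>' + \<beta>') = - (\<tau> * \<alpha>') + \<tau> * \<beta>'" by (simp add: algebra_simps)
    also have "\<dots> = t * \<alpha>" unfolding y g using eq(1) by (simp add: algebra_simps)
    also have "\<dots> = \<tau> * (\<tau> * \<alpha>)" by (simp add: ACt power2_eq_square)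
    finally have 1: "\<tau> * (- \<alpha>' + \<beta>') = \<tau> * (\<tau> * \<alpha>)" .
    have "\<tau> * (\<alpha>' + C * \<gamma>') = \<tau> * \<alpha>' + C * (\<tau> * \<gamma>')" by (simp add: algebra_simps)
    also have "\<dots> = t * \<beta>" unfolding y g using eq(2) by (simp add: algebra_simps)
    also have "\<dots> = \<tau> * (\<tau> * \<beta>)" by (simp add: ACt power2_eq_square)
    finally have 2: "\<tau> * (\<alpha>' + C * \<gamma>') = \<tau> * (\<tau> * \<beta>)" .
    show "\<tau> * \<alpha> = - \<alpha>' + \<beta>'" "\<tau> * \<beta> = \<alpha>' + C * \<gamma>'"
      using cancel[OF 1] cancel[OF 2] by simp_all
    then show "\<tau> * \<gamma> = \<beta>' + C * \<gamma>'" unfolding g by (simp add: algebra_simps)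
  qed
  define e1 where "e1 i = (if i = 0 then \<beta> else if i = r - 1 then \<alpha> else \<gamma>)" for i
  define e2 where "e2 j = (if j = 0 then \<beta>' else if j = s - 1 then \<alpha>' else \<gamma>')" for j
  let ?w = "gamma_weight 0 0 (r - 1) (s - 1)"
  have rows: "(\<Sum>j<s. ?w i j * e2 j) = \<tau> * e1 i" if "i < r" for i
  proof -
    have "(\<Sum>j<s. ?w i j * e2 j) = ?w i 0 * e2 0 + ?w i (s - 1) * e2 (s - 1) + C * (if i = r - 1 then 0 else \<gamma>')"
      unfolding ACt by (rule sum_lessThan_ends) (use rs in \<open>auto simp: gamma_weight_def e2_def\<close>)
    also have "\<dots> = \<tau> * e1 i"
      using rs by (cases "i = 0"; cases "i = r - 1") (simp_all add: gamma_weight_def e1_def e2_def x)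
    finally show ?thesis .
  qed
  have cols: "(\<Sum>i<r. ?w i j * e1 i) = \<tau> * e2 j" if "j < s" for j
  proof -
    have "(\<Sum>i<r. ?w i j * e1 i) = ?w 0 j * e1 0 + ?w (r - 1) j * e1 (r - 1) + A * (if j = s - 1 then 0 else \<gamma>)"
      unfolding ACt by (rule sum_lessThan_ends) (use rs in \<open>auto simp: gamma_weight_def e1_def\<close>)
    also have "\<dots> = \<tau> * e2 j"
      using rs by (cases "j = 0"; cases "j = s - 1") (simp_all add: gamma_weight_def e1_def e2_def y)
    finally show ?thesis .
  qed
  define e where "e a = (case a of Inl i \<Rightarrow> e1 i | Inr j \<Rightarrow> e2 j)" for a
  have sum: "(\<Sum>b\<in>sverts ?G. \<psi> b) = (\<Sum>i<r. \<psi> (Inl i)) + (\<Sum>j<s. \<psi> (Inr j))" for \<psi> :: "nat + nat \<Rightarrow> real"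
    unfolding sverts_Gamma_rs[OF rs2]
    by (subst sum.union_disjoint) (auto simp: sum.reindex)
  show ?thesis
  proof
    have "e (Inl 0) = \<beta>" "e (Inl (r - 1)) = \<alpha>" using rs by (simp_all add: e_def e1_def)
    moreover have "Inl 0 \<in> sverts ?G" "Inl (r - 1) \<in> sverts ?G" using rs2 by (auto simp: sverts_Gamma_rs)
    ultimately show "\<exists>a\<in>sverts ?G. e a \<noteq> 0" using nz by metis
  next
    fix a assume "a \<in> sverts ?G"
    then consider i where "a = Inl i" "i < r" | j where "a = Inr j" "j < s"
      by (auto simp: sverts_Gamma_rs[OF rs2])
    then show "(\<Sum>b\<in>sverts ?G. sg_weight ?G a b * e b) = \<tau> * e a"
    proof cases
      case 1
      then show ?thesis using rows[of i] by (simp add: sum sg_weight_Gamma_rs[OF rs2] e_def)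
    next
      case 2
      then show ?thesis using cols[of j] by (simp add: sum sg_weight_Gamma_rs[OF rs2] e_def)
    qed
  qed
qed

text \<open>An eigenvector pulls back along the isomorphism once its signs are changed on the
  switching set \<open>U\<close>.\<close>

lemma switching_isomorphic_eigenvalue:
  assumes \<Gamma>: "signed_graph \<Gamma>" and iso: "switching_isomorphic \<Gamma> \<Gamma>'"
    and loopfree: "\<And>a. (a, a) \<notin> sarcs \<Gamma>'"
    and e: "\<exists>a\<in>sverts \<Gamma>'. e a \<noteq> 0"
      "\<And>a. a \<in> sverts \<Gamma>' \<Longrightarrow> (\<Sum>b\<in>sverts \<Gamma>'. sg_weight \<Gamma>' a b * e b) = \<tau> * e a"
  shows "\<bar>\<tau>\<bar> \<le> sg_spectral_radius \<Gamma>"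
proof -
  obtain H where eqv: "switching_equivalent \<Gamma>' H" and sgi: "sg_isomorphic \<Gamma> H"
    using iso unfolding switching_isomorphic_def by blast
  obtain U where H: "fst H = fst \<Gamma>'"
    and signH: "\<forall>(u, v) \<in> sarcs \<Gamma>'. esign H u v = esign (switch U \<Gamma>') u v"
    using eqv unfolding switching_equivalent_def by blast
  obtain F where F: "bij_betw F (sverts \<Gamma>) (sverts H)"
    and arcs: "\<forall>u \<in> sverts \<Gamma>. \<forall>v \<in> sverts \<Gamma>. (u, v) \<in> sarcs \<Gamma> \<longleftrightarrow> (F u, F v) \<in> sarcs H"
    and sign: "\<forall>(u, v) \<in> sarcs \<Gamma>. esign H (F u) (F v) = esign \<Gamma> u v"
    using sgi unfolding sg_isomorphic_def by blast
  define \<epsilon> where "\<epsilon> a = (if a \<in> U then -1 else 1 :: real)" for a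
  have \<epsilon>2: "\<epsilon> a * \<epsilon> a = 1" for a by (simp add: \<epsilon>_def)
  have W: "sg_weight \<Gamma> u v = \<epsilon> (F u) * \<epsilon> (F v) * sg_weight \<Gamma>' (F u) (F v)"
    if "u \<in> sverts \<Gamma>" "v \<in> sverts \<Gamma>" for u v
  proof (cases "(u, v) \<in> sarcs \<Gamma>")
    case True
    then have FA: "(F u, F v) \<in> sarcs \<Gamma>'" using arcs that H by auto
    then have "F u \<noteq> F v" using loopfree by metis
    have "esign \<Gamma> u v = esign (switch U \<Gamma>') (F u) (F v)"
      using bspec[OF sign True] bspec[OF signH FA] by simp
    then show ?thesis using True FA
      unfolding esign_switch[OF \<open>F u \<noteq> F v\<close>] by (simp add: sg_weight_def \<epsilon>_def)
  next
    case False
    then show ?thesis using arcs that H by (auto simp: sg_weight_def)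
  qed
  have F': "bij_betw F (sverts \<Gamma>) (sverts \<Gamma>')" using F H by simp
  define x where "x u = \<epsilon> (F u) * e (F u)" for u
  have eig: "(\<Sum>v\<in>sverts \<Gamma>. sg_weight \<Gamma> u v * x v) = \<tau> * x u" if u: "u \<in> sverts \<Gamma>" for u
  proof -
    have "(\<Sum>v\<in>sverts \<Gamma>. sg_weight \<Gamma> u v * x v)
        = (\<Sum>v\<in>sverts \<Gamma>. \<epsilon> (F u) * (sg_weight \<Gamma>' (F u) (F v) * e (F v)))"
    proof (rule sum.cong)
      fix v assume v: "v \<in> sverts \<Gamma>"
      have "sg_weight \<Gamma> u v * x v = (\<epsilon> (F v) * \<epsilon> (F v)) * (\<epsilon> (F u) * (sg_weight \<Gamma>' (F u) (F v) * e (F v)))"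
        unfolding W[OF u v] x_def by (simp only: mult_ac)
      then show "sg_weight \<Gamma> u v * x v = \<epsilon> (F u) * (sg_weight \<Gamma>' (F u) (F v) * e (F v))"
        by (simp only: \<epsilon>2 mult_1)
    qed simp
    also have "\<dots> = \<epsilon> (F u) * (\<Sum>b\<in>sverts \<Gamma>'. sg_weight \<Gamma>' (F u) b * e b)"
      unfolding sum_distrib_left[symmetric] by (subst sum.reindex_bij_betw[OF F']) simp
    also have "\<dots> = \<tau> * x u"
      using e(2)[of "F u"] bij_betwE[OF F'] u by (simp add: x_def)
    finally show ?thesis .
  qed
  obtain a where a: "a \<in> sverts \<Gamma>'" "e a \<noteq> 0" using e(1) by blast
  then obtain u where "u \<in> sverts \<Gamma>" "F u = a" using F' by (metis bij_betw_def imageE)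
  then show ?thesis
    using spectral_radius_ge_eigenvalue[OF \<Gamma>, of u x \<tau>] eig a by (simp add: x_def \<epsilon>_def)
qed

section \<open>The bound and the case of equality\<close>

text \<open>In the cyclic order \<open>u1\<close>, \<open>v1\<close>, \<open>P\<close>,
  \<open>B\<close>, \<open>A\<close>, \<open>Q\<close> of the classes, each case of
  \<open>sizes\<close> makes four consecutive classes singletons. They form the path of length three
  of the extremal graph, whose middle edge has to carry the negative sign after switching.\<close>

lemma extremal_switching_isomorphic:
  assumes \<Gamma>: "signed_graph \<Gamma>" and bip: "bipartition \<Gamma> X Y" and s: "\<And>u. s u \<in> {-1, 1 :: real}"
    and edge: "negative_edge X Y w z \<rho> u1 v1"
    and w: "w = (\<lambda>u v. s u * s v * sg_weight \<Gamma> u v)"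
    and struct: "\<And>x y. x \<in> X \<Longrightarrow> y \<in> Y \<Longrightarrow> w x y = hexagon_weight w u1 v1 x y"
    and sizes: "card (pos_nbrs w X v1) = 1 \<and> card (pos_nbrs w Y u1) = 1
      \<or> card (pos_nbrs w X v1) = 1 \<and> card (other_nbrs w Y u1 v1) = 1
      \<or> card (other_nbrs w X v1 u1) = 1 \<and> card (pos_nbrs w Y u1) = 1"
  shows "switching_isomorphic \<Gamma> (Gamma_rs (card X) (card Y))"
proof -
  interpret negative_edge X Y w z \<rho> u1 v1 by (fact edge)
  have w': "s x * s y * sg_weight \<Gamma> x y = hexagon_weight w u1 v1 x y" if "x \<in> X" "y \<in> Y" for x y
    using struct[OF that] by (simp add: w)
  have disj: "x \<noteq> y" if "x \<in> X" "y \<in> Y" for x y using that disjoint by blast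
  note iso = switching_isomorphic_Gamma_rs[OF \<Gamma> bip refl refl]
  consider (PQ) "card P = 1" "card Q = 1" | (PB) "card P = 1" "card B = 1" | (AQ) "card A = 1" "card Q = 1"
    using sizes by blast
  then show ?thesis
  proof cases
    case PQ
    obtain u v where P: "P = {u}" and Q: "Q = {v}" using PQ by (auto simp: card_1_singleton_iff)
    have iP: "w v1 i = 1 \<longleftrightarrow> i = u" if "i \<in> X" for i
      using P mem_P[of i] that w_sym[of v1 i] by auto
    have jQ: "w u1 j = 1 \<longleftrightarrow> j = v" if "j \<in> Y" for j
      using Q mem_Q[of j] that by auto
    have "u \<in> X" "u \<noteq> u1" "v \<in> Y" "v \<noteq> v1"
      using P Q X_partition(2) Y_partition(2) mem_P[of u] mem_Q[of v] by auto
    then show ?thesis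
      using u1 v1 s by (intro iso[of u u1 v v1 s]) (auto simp: w' hexagon_weight_def gamma_weight_def iP jQ)
  next
    case PB
    \<comment> \<open>The vertex of \<open>P\<close> plays the role of \<open>u1\<close>, after switching at \<open>v1\<close>.\<close>
    obtain u v where P: "P = {u}" and B: "B = {v}" using PB by (auto simp: card_1_singleton_iff)
    have iP: "w v1 i = 1 \<longleftrightarrow> i = u" if "i \<in> X" for i
      using P mem_P[of i] that w_sym[of v1 i] by auto
    have jB: "w u1 j = 1 \<longleftrightarrow> j \<noteq> v1 \<and> j \<noteq> v" if "j \<in> Y" for j
    proof (cases "j = v1")
      case False
      then show ?thesis using mem_B[of j] that unfolding B by blast
    qed (simp add: neg)
    have uv: "u \<in> X" "u \<noteq> u1" "v \<in> Y" "v \<noteq> v1"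
      using P B X_partition(2) Y_partition(2) mem_P[of u] mem_B[of v] by auto
    define s' where "s' = s(v1 := - s v1)"
    have weight: "s' x * s' y * sg_weight \<Gamma> x y = gamma_weight u1 v u v1 x y" if "x \<in> X" "y \<in> Y" for x y
    proof -
      have "s' x * s' y * sg_weight \<Gamma> x y = (if y = v1 then -1 else 1) * hexagon_weight w u1 v1 x y"
        unfolding w'[OF that, symmetric] using disj[OF that(1) v1] by (simp add: s'_def)
      also have "\<dots> = gamma_weight u1 v u v1 x y"
        unfolding hexagon_weight_def gamma_weight_def iP[OF that(1)] jB[OF that(2)] using uv by auto
      finally show ?thesis .
    qed
    show ?thesis
      by (rule iso[of u1 u v v1 s']) (use u1 v1 uv s weight in \<open>auto simp: s'_def\<close>)
  next
    case AQ
    \<comment> \<open>The vertex of \<open>Q\<close> plays the role of \<open>v1\<close>, after switching at \<open>u1\<close>.\<close>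
    obtain u v where A: "A = {u}" and Q: "Q = {v}" using AQ by (auto simp: card_1_singleton_iff)
    have iA: "w v1 i = 1 \<longleftrightarrow> i \<noteq> u1 \<and> i \<noteq> u" if "i \<in> X" for i
    proof (cases "i = u1")
      case False
      then show ?thesis using mem_A[of i] that unfolding A w_sym[of v1 i] by blast
    qed (simp add: neg w_sym[of v1 u1])
    have jQ: "w u1 j = 1 \<longleftrightarrow> j = v" if "j \<in> Y" for j
      using Q mem_Q[of j] that by auto
    have uv: "u \<in> X" "u \<noteq> u1" "v \<in> Y" "v \<noteq> v1"
      using A Q X_partition(2) Y_partition(2) mem_A[of u] mem_Q[of v] by auto
    define s' where "s' = s(u1 := - s u1)"
    have weight: "s' x * s' y * sg_weight \<Gamma> x y = gamma_weight u v1 u1 v x y" if "x \<in> X" "y \<in> Y" for x y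
    proof -
      have "s' x * s' y * sg_weight \<Gamma> x y = (if x = u1 then -1 else 1) * hexagon_weight w u1 v1 x y"
        unfolding w'[OF that, symmetric] using disj[OF u1 that(2)] by (simp add: s'_def)
      also have "\<dots> = gamma_weight u v1 u1 v x y"
        unfolding hexagon_weight_def gamma_weight_def iA[OF that(1)] jQ[OF that(2)] using uv by auto
      finally show ?thesis .
    qed
    show ?thesis
      by (rule iso[of u u1 v1 v s']) (use u1 v1 uv s weight in \<open>auto simp: s'_def\<close>)
  qed
qed

text \<open>The sum of the squared row bounds lies between the squared spectral radius and
  \<open>(extremal_radius n)\<^sup>2\<close>, each times the norm on \<open>Y\<close>. Ordering the
  parts by size matches them with the two indices of \<open>Gamma_rs\<close>.\<close>

lemma spectral_radius_bound:
  fixes \<Gamma> :: "'a signed_graph" and n :: nat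
  assumes \<Gamma>: "signed_graph \<Gamma>"
    and card: "card (sverts \<Gamma>) = n" and n: "n \<ge> 6"
    and bip: "bipartition \<Gamma> X Y" and le: "card X \<le> card Y"
    and unb: "unbalanced \<Gamma>"
    and no4: "\<not> (\<exists>p. negative_cycle \<Gamma> p \<and> length p = 4)"
    and pos: "sg_spectral_radius \<Gamma> > 0"
  shows "sg_spectral_radius \<Gamma> \<le> extremal_radius n"
    and "sg_spectral_radius \<Gamma> = extremal_radius n \<Longrightarrow>
      switching_isomorphic \<Gamma> (Gamma_rs (n div 2) ((n + 1) div 2))"
proof -
  let ?\<rho> = "sg_spectral_radius \<Gamma>" and ?t = "(extremal_radius n)\<^sup>2"
  have ne: "sverts \<Gamma> \<noteq> {}" using card n by auto
  obtain s z where s: "\<And>u. s u \<in> {-1, 1}"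
    and nn: "nonneg_eigenvector X Y (\<lambda>u v. s u * s v * sg_weight \<Gamma> u v) z ?\<rho>"
    by (rule nonneg_switching[OF \<Gamma> bip no4 unb pos ne]) blast
  define w where "w = (\<lambda>u v. s u * s v * sg_weight \<Gamma> u v)"
  have nn: "nonneg_eigenvector X Y w z ?\<rho>" using nn by (simp add: w_def)
  obtain u1 v1 where "u1 \<in> X" "v1 \<in> Y" "w u1 v1 = -1"
    using nonneg_eigenvector.negative_edge_exists[OF nn] by blast
  then have edge: "negative_edge X Y w z ?\<rho> u1 v1"
    using nn by (simp add: negative_edge_def negative_edge_axioms_def)
  then interpret negative_edge X Y w z ?\<rho> u1 v1 .
  have XY: "X \<union> Y = sverts \<Gamma>" using bip by (auto simp: bipartition_def)
  have "card X + card Y = n"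
    using card_Un_disjoint[OF finite disjoint] XY card by simp
  then have RS: "card X - 1 = card P + card A" "card Y - 1 = card Q + card B"
    "(card X - 1) + (card Y - 1) = n - 2" "card X - 1 \<le> card Y - 1"
    using card_X card_Y le by simp_all
  note root = extremal_radius_root[OF n]
  note quad = hexagon_quadratic_extremal[OF cards_ge_1 RS n root(2,3), folded hexagon_trace_def hexagon_minors_def]
  let ?N = "\<Sum>y\<in>Y. (z y)\<^sup>2"
  have "?\<rho>\<^sup>2 * ?N \<le> ?t * ?N"
    using sum_eigen_le hexagon_bound(1)[OF quad(1,2)] by linarith
  then have "?\<rho>\<^sup>2 \<le> ?t" using sum_squares_pos by simp
  then show "?\<rho> \<le> extremal_radius n" using root(1) by (simp add: power2_le_iff_abs_le)
  assume eq: "?\<rho> = extremal_radius n"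
  \<comment> \<open>A positive value would make the hexagon bound strict, against the lower bound
    \<open>sum_eigen_le\<close>.\<close>
  have "\<not> ?t\<^sup>2 - hexagon_trace * ?t + hexagon_minors > 0"
    using hexagon_bound(2)[OF quad(1,2)] sum_eigen_le by (auto simp: eq)
  then have zero: "?t\<^sup>2 - hexagon_trace * ?t + hexagon_minors = 0" using quad(2) by simp
  note sizes = quad(3)[OF zero]
  have w_eq: "w x y = hexagon_weight w u1 v1 x y" if "x \<in> X" "y \<in> Y" for x y
    using equality_weight[OF _ _ that] quad(1,2) by (simp add: eq)
  have "switching_isomorphic \<Gamma> (Gamma_rs (card X) (card Y))"
    using extremal_switching_isomorphic[OF \<Gamma> bip s edge w_def w_eq] sizes by blast
  moreover have "card X = n div 2" "card Y = (n + 1) div 2"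
    using sizes card_X card_Y n \<open>card X + card Y = n\<close> by auto
  ultimately show "switching_isomorphic \<Gamma> (Gamma_rs (n div 2) ((n + 1) div 2))" by simp
qed

lemma extremal_radius_le_of_isomorphic:
  assumes \<Gamma>: "signed_graph \<Gamma>" and n: "n \<ge> 6"
    and iso: "switching_isomorphic \<Gamma> (Gamma_rs (n div 2) ((n + 1) div 2))"
  shows "extremal_radius n \<le> sg_spectral_radius \<Gamma>"
proof -
  let ?G = "Gamma_rs (n div 2) ((n + 1) div 2)"
  note root = extremal_radius_root[OF n]
  have rs: "n div 2 \<ge> 3" "(n + 1) div 2 \<ge> 3" using n by auto
  obtain e where e: "\<exists>a\<in>sverts ?G. e a \<noteq> 0"
    "\<And>a. a \<in> sverts ?G \<Longrightarrow> (\<Sum>b\<in>sverts ?G. sg_weight ?G a b * e b) = extremal_radius n * e a"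
    by (rule Gamma_rs_eigenvector[OF rs root(1,2)]) blast
  have "(a, a) \<notin> sarcs ?G" for a by (cases a) (simp_all add: sarcs_Gamma_rs)
  then have "\<bar>extremal_radius n\<bar> \<le> sg_spectral_radius \<Gamma>"
    using switching_isomorphic_eigenvalue[OF \<Gamma> iso _ e] by blast
  then show ?thesis by simp
qed

theorem theorem1p2:
  fixes \<Gamma> :: "'a signed_graph" and n :: nat
  assumes "signed_graph \<Gamma>"
    and "card (sverts \<Gamma>) = n" and "n \<ge> 6"
    and "sg_bipartite \<Gamma>"
    and "unbalanced \<Gamma>"
    and "\<not> (\<exists>p. negative_cycle \<Gamma> p \<and> length p = 4)"
  shows "let B =
      (if even n
       then (1/4) * (real n - 6 + sqrt ((real n - 2) * (real n + 6)))
       else sqrt ((1/8) * ((real n)\<^sup>2 - 4 * real n + 11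
              + sqrt (((real n)\<^sup>2 - 4 * real n + 11)\<^sup>2 - 64 * (real n - 2) * (real n - 4)))))
    in sg_spectral_radius \<Gamma> \<le> B \<and>
       (sg_spectral_radius \<Gamma> = B \<longleftrightarrow>
          switching_isomorphic \<Gamma> (Gamma_rs (n div 2) ((n + 1) div 2)))"
proof -
  let ?\<rho> = "sg_spectral_radius \<Gamma>" and ?G = "Gamma_rs (n div 2) ((n + 1) div 2)"
  obtain X Y where bip: "bipartition \<Gamma> X Y" and le: "card X \<le> card Y"
  proof -
    obtain X Y where "bipartition \<Gamma> X Y"
      using assms(4) by (auto simp: sg_bipartite_def bipartition_def)
    then show ?thesis using that[of X Y] that[of Y X] bipartition_swap by (metis le_cases)
  qed
  have "?\<rho> \<le> extremal_radius n \<and> (?\<rho> = extremal_radius n \<longleftrightarrow> switching_isomorphic \<Gamma> ?G)"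
  proof (cases "?\<rho> > 0")
    case True
    then show ?thesis
      using spectral_radius_bound[OF assms(1-3) bip le assms(5,6)]
        extremal_radius_le_of_isomorphic[OF assms(1,3)] by (metis order_antisym)
  next
    \<comment> \<open>A spectral radius that is not positive lies strictly below the bound, and the
      extremal graph is excluded because it would force the radius up to the bound; so both sides of
      the equivalence fail.\<close>
    case False
    then show ?thesis
      using extremal_radius_root(1)[OF assms(3)] extremal_radius_le_of_isomorphic[OF assms(1,3)] by force
  qed
  then show ?thesis unfolding extremal_radius_def Let_def .
qed

end
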